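(* There exist a finite group $G$ and subsets $S_1,S_2,S_3\subseteq G$ satisfying the triple product property such that $|S_1||S_2||S_3| > \sum_i d_i^3$, where $\{d_i\}$ are the character degrees of $G$.
   Context: For a subset $S$ of a group, $Q(S)=\{s_1s_2^{-1}: s_1,s_2\in S\}$. Subsets $S_1,S_2,S_3$ of a group satisfy the triple product property if for all $q_i\in Q(S_i)$ ($i=1,2,3$), $q_1q_2q_3=1$ implies $q_1=q_2=q_3=1$. The character degrees of a finite group $G$ are the dimensions $d_1,\dots,d_k$ of its irreducible complex representations, one for each isomorphism class (so $\sum_i d_i^2=|G|$). *)

theory Defs
  imports Jordan_Normal_Form.VS_Connect
begin

definition quotient_set :: "('a, 'b) monoid_scheme \<Rightarrow> 'a set \<Rightarrow> 'a set" where
  "quotient_set G S = {s \<otimes>\<^bsub>G\<^esub> inv\<^bsub>G\<^esub> t | s t. s \<in> S \<and> t \<in> S}"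

definition triple_product_property ::
    "('a, 'b) monoid_scheme \<Rightarrow> 'a set \<Rightarrow> 'a set \<Rightarrow> 'a set \<Rightarrow> bool" where
  "triple_product_property G S1 S2 S3 \<longleftrightarrow>
     (\<forall>q1 \<in> quotient_set G S1. \<forall>q2 \<in> quotient_set G S2. \<forall>q3 \<in> quotient_set G S3.
        q1 \<otimes>\<^bsub>G\<^esub> q2 \<otimes>\<^bsub>G\<^esub> q3 = \<one>\<^bsub>G\<^esub> \<longrightarrow> q1 = \<one>\<^bsub>G\<^esub> \<and> q2 = \<one>\<^bsub>G\<^esub> \<and> q3 = \<one>\<^bsub>G\<^esub>)"

definition general_linear :: "nat \<Rightarrow> complex mat monoid" where
  "general_linear n = units_of (ring_mat TYPE(complex) n ())"

definition representation :: "('a, 'b) monoid_scheme \<Rightarrow> nat \<Rightarrow> ('a \<Rightarrow> complex mat) \<Rightarrow> bool" where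
  "representation G n \<rho> \<longleftrightarrow> \<rho> \<in> hom G (general_linear n)"

definition irreducible_representation ::
    "('a, 'b) monoid_scheme \<Rightarrow> nat \<Rightarrow> ('a \<Rightarrow> complex mat) \<Rightarrow> bool" where
  "irreducible_representation G n \<rho> \<longleftrightarrow>
     representation G n \<rho> \<and> 0 < n \<and>
     (\<forall>W. VectorSpace.subspace class_ring W (module_vec TYPE(complex) n) \<and>
          (\<forall>g \<in> carrier G. \<forall>w \<in> W. \<rho> g *\<^sub>v w \<in> W) \<longrightarrow>
          W = {0\<^sub>v n} \<or> W = carrier_vec n)"

definition isomorphic_representations ::
    "('a, 'b) monoid_scheme \<Rightarrow> nat \<Rightarrow> ('a \<Rightarrow> complex mat) \<Rightarrow> nat \<Rightarrow> ('a \<Rightarrow> complex mat) \<Rightarrow> bool" where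
  "isomorphic_representations G m \<rho> n \<sigma> \<longleftrightarrow>
     m = n \<and> (\<exists>P \<in> carrier (general_linear n). \<forall>g \<in> carrier G. P * \<rho> g = \<sigma> g * P)"

text \<open>The list \<open>ds\<close> consists of the dimensions, with multiplicity and in some order, of a complete
  list of pairwise non-isomorphic irreducible complex representations of \<open>G\<close>. That such a finite list
  exists is part of the predicate, so no sum over the degrees can be taken over an infinite set
  (where Isabelle would silently return 0).\<close>

definition character_degrees :: "('a, 'b) monoid_scheme \<Rightarrow> nat list \<Rightarrow> bool" where
  "character_degrees G ds \<longleftrightarrow>
     (\<exists>\<rho>s. length \<rho>s = length ds \<and>
        (\<forall>i < length ds. irreducible_representation G (ds ! i) (\<rho>s ! i)) \<and>
        (\<forall>i < length ds. \<forall>j < length ds.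
           isomorphic_representations G (ds ! i) (\<rho>s ! i) (ds ! j) (\<rho>s ! j) \<longrightarrow> i = j) \<and>
        (\<forall>n \<sigma>. irreducible_representation G n \<sigma> \<longrightarrow>
           (\<exists>i < length ds. isomorphic_representations G n \<sigma> (ds ! i) (\<rho>s ! i))))"

end

theory Submission
  imports
    Defs
    "HOL-Algebra.Weak_Morphisms"
    "HOL-Computational_Algebra.Fundamental_Theorem_Algebra"
    "HOL-Library.Countable"
    "HOL-Library.Numeral_Type"
    "HOL-Library.Product_Plus"
begin

text \<open>The group is the wreath product of \<open>H = (\<int>/5)\<^sup>3\<close> with the group of order 2 (Cohn, Kleinberg,
  Szegedy and Umans), that is, \<open>H\<^sup>2\<close> extended by the swap of the two factors. With \<open>H\<^sub>1, H\<^sub>2, H\<^sub>3\<close> the coordinate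
  axes of \<open>H\<close>, the sets \<open>S\<^sub>i = {(a, b) z\<^sup>j | a \<in> H\<^sub>i - {0}, b \<in> H\<^sub>i\<^sub>+\<^sub>1}\<close> satisfy the triple product property: the number
  of swaps among the three quotients is even, and if it is two, then some coordinate of the product is a single
  nonzero entry. A common eigenvector \<open>v\<close> of the abelian base \<open>H\<^sup>2\<close> in an irreducible representation spans,
  together with its swap, everything; so the representation is either one of the \<open>2 N\<close> extensions of a character
  \<open>\<alpha> \<otimes> \<alpha>\<close> or the two-dimensional representation induced from \<open>\<alpha> \<otimes> \<beta>\<close>, one for each unordered pair
  \<open>\<alpha> \<noteq> \<beta>\<close> of characters of \<open>H\<close>, where \<open>N\<close> is the number of characters of \<open>H\<close>. Hence the sum of the cubes of the degrees is
  \<open>4 N\<^sup>2 - 2 N\<close>, and \<open>N \<le> 125\<close> bounds it by \<open>62250 < 64000 = 40\<^sup>3\<close>.\<close>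

section \<open>Representations and Schur's lemma\<close>

text \<open>Turns the subspace condition hidden in irreducibility into closure properties of a plain
  set of vectors, the form in which all later irreducibility arguments work.\<close>

lemma subspace_module_vec_iff:
  fixes W :: "'a::field vec set"
  shows "VectorSpace.subspace class_ring W (module_vec TYPE('a) n) \<longleftrightarrow>
    W \<subseteq> carrier_vec n \<and> 0\<^sub>v n \<in> W \<and> (\<forall>v\<in>W. \<forall>w\<in>W. v + w \<in> W) \<and> (\<forall>c. \<forall>v\<in>W. c \<cdot>\<^sub>v v \<in> W)"
proof -
  interpret vec_space "TYPE('a)" n .
  show ?thesis
    using vec_vs vec_module by (auto simp: VectorSpace.subspace_def submodule_def module_vec_simps)
qed

lemma general_linearI:
  assumes "P \<in> carrier_mat n n" "Q \<in> carrier_mat n n" "P * Q = 1\<^sub>m n" "Q * P = 1\<^sub>m n"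
  shows "P \<in> carrier (general_linear n)"
  using assms by (auto simp: general_linear_def units_of_def Units_def ring_mat_simps)

lemma general_linearE:
  assumes "P \<in> carrier (general_linear n)"
  obtains Q where "P \<in> carrier_mat n n" "Q \<in> carrier_mat n n" "P * Q = 1\<^sub>m n" "Q * P = 1\<^sub>m n"
  using assms by (auto simp: general_linear_def units_of_def Units_def ring_mat_simps)

lemma representation_carrier:
  "representation G n \<rho> \<Longrightarrow> g \<in> carrier G \<Longrightarrow> \<rho> g \<in> carrier_mat n n"
  unfolding representation_def by (meson general_linearE hom_in_carrier)

lemma representation_mult:
  "representation G n \<rho> \<Longrightarrow> g \<in> carrier G \<Longrightarrow> h \<in> carrier G \<Longrightarrow> \<rho> (g \<otimes>\<^bsub>G\<^esub> h) = \<rho> g * \<rho> h"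
  unfolding representation_def
  by (auto dest: hom_mult simp: general_linear_def units_of_def ring_mat_simps)

text \<open>\<open>hom\<close> only gives multiplicativity, so the value at the identity is
  idempotent; being invertible, it is the identity matrix.\<close>

lemma representation_one:
  assumes "group G" "representation G n \<rho>"
  shows "\<rho> \<one>\<^bsub>G\<^esub> = 1\<^sub>m n"
proof -
  interpret G: group G by fact
  obtain Q where Q: "\<rho> \<one>\<^bsub>G\<^esub> \<in> carrier_mat n n" "Q \<in> carrier_mat n n" "Q * \<rho> \<one>\<^bsub>G\<^esub> = 1\<^sub>m n"
    using assms(2) unfolding representation_def
    by (meson general_linearE hom_in_carrier G.one_closed)
  have "\<rho> \<one>\<^bsub>G\<^esub> * \<rho> \<one>\<^bsub>G\<^esub> = \<rho> \<one>\<^bsub>G\<^esub>"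
    using representation_mult[OF assms(2) G.one_closed G.one_closed] by simp
  then have "(Q * \<rho> \<one>\<^bsub>G\<^esub>) * \<rho> \<one>\<^bsub>G\<^esub> = Q * \<rho> \<one>\<^bsub>G\<^esub>"
    using assoc_mult_mat[OF Q(2) Q(1) Q(1)] by simp
  then show ?thesis using Q by simp
qed

text \<open>Multiplicativity and the value at the identity make the image of the group inverse a
  two-sided inverse of \<open>\<rho> g\<close>.\<close>

lemma representationI:
  assumes "group G" "\<And>g. g \<in> carrier G \<Longrightarrow> \<rho> g \<in> carrier_mat n n"
    and mult: "\<And>g h. g \<in> carrier G \<Longrightarrow> h \<in> carrier G \<Longrightarrow> \<rho> (g \<otimes>\<^bsub>G\<^esub> h) = \<rho> g * \<rho> h"
    and "\<rho> \<one>\<^bsub>G\<^esub> = 1\<^sub>m n"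
  shows "representation G n \<rho>"
proof -
  interpret G: group G by fact
  have "\<rho> g \<in> carrier (general_linear n)" if "g \<in> carrier G" for g
    by (rule general_linearI[where Q = "\<rho> (inv\<^bsub>G\<^esub> g)"])
       (use that assms in \<open>simp_all flip: mult\<close>)
  then show ?thesis
    using mult
    by (auto simp: representation_def hom_def general_linear_def units_of_def ring_mat_simps)
qed

section \<open>Schur's lemma for matrix representations\<close>

lemma mult_mat_vec_zero: "P \<in> carrier_mat n k \<Longrightarrow> P *\<^sub>v 0\<^sub>v k = (0\<^sub>v n :: 'a::semiring_0 vec)"
  by (auto intro!: eq_vecI simp: scalar_prod_def)

lemma mult_mat_vec_unit_vec:
  fixes P :: "'a::semiring_1 mat"
  assumes "P \<in> carrier_mat n k" "j < k"
  shows "P *\<^sub>v unit_vec k j = col P j"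
proof (rule eq_vecI)
  show "dim_vec (P *\<^sub>v unit_vec k j) = dim_vec (col P j)" using assms by simp
  fix i assume "i < dim_vec (col P j)"
  then have "i < n" using assms by simp
  then show "(P *\<^sub>v unit_vec k j) $ i = col P j $ i"
    using assms by (simp add: scalar_prod_right_unit)
qed

text \<open>The traces of \<open>P * Q\<close> and \<open>Q * P\<close> are the same double sum, and
  they equal \<open>n\<close> and \<open>k\<close>; characteristic zero lets the equality descend to
  natural numbers.\<close>

lemma two_sided_inverse_imp_square:
  fixes P Q :: "'a::field_char_0 mat"
  assumes "P \<in> carrier_mat n k" "Q \<in> carrier_mat k n" "P * Q = 1\<^sub>m n" "Q * P = 1\<^sub>m k"
  shows "n = k"
proof -
  have "of_nat n = (\<Sum>i<n. (1\<^sub>m n :: 'a mat) $$ (i,i))" by simp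
  also have "\<dots> = (\<Sum>i<n. \<Sum>j<k. P $$ (i,j) * Q $$ (j,i))"
    unfolding assms(3)[symmetric] using assms(1,2)
    by (intro sum.cong) (auto simp: scalar_prod_def lessThan_atLeast0)
  also have "\<dots> = (\<Sum>j<k. \<Sum>i<n. Q $$ (j,i) * P $$ (i,j))"
    by (subst sum.swap) (simp add: mult.commute)
  also have "\<dots> = (\<Sum>i<k. (1\<^sub>m k :: 'a mat) $$ (i,i))"
    unfolding assms(4)[symmetric] using assms(1,2)
    by (intro sum.cong) (auto simp: scalar_prod_def lessThan_atLeast0)
  also have "\<dots> = of_nat k" by simp
  finally show ?thesis by simp
qed

lemma irreducible_representation_subspace:
  assumes "irreducible_representation G n \<rho>"
    and "W \<subseteq> carrier_vec n" "0\<^sub>v n \<in> W" "\<And>v w. v \<in> W \<Longrightarrow> w \<in> W \<Longrightarrow> v + w \<in> W"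
    and "\<And>c v. v \<in> W \<Longrightarrow> c \<cdot>\<^sub>v v \<in> W"
    and "\<And>g w. g \<in> carrier G \<Longrightarrow> w \<in> W \<Longrightarrow> \<rho> g *\<^sub>v w \<in> W"
  shows "W = {0\<^sub>v n} \<or> W = carrier_vec n"
proof -
  have "VectorSpace.subspace class_ring W (module_vec TYPE(complex) n)"
    using assms(2-5) by (simp add: subspace_module_vec_iff)
  then show ?thesis
    using assms(1,6) unfolding irreducible_representation_def by blast
qed

text \<open>Schur's lemma: the range and the kernel of an intertwiner are invariant subspaces.\<close>

lemma nonzero_intertwiner_imp_isomorphic:
  assumes \<sigma>: "irreducible_representation G n \<sigma>" and \<tau>: "irreducible_representation G k \<tau>"
    and P: "P \<in> carrier_mat n k" "P \<noteq> 0\<^sub>m n k"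
    and comm: "\<And>g. g \<in> carrier G \<Longrightarrow> \<sigma> g * P = P * \<tau> g"
  shows "isomorphic_representations G n \<sigma> k \<tau>"
proof -
  have r\<sigma>: "representation G n \<sigma>" and r\<tau>: "representation G k \<tau>"
    using \<sigma> \<tau> by (auto simp: irreducible_representation_def)
  have commv: "\<sigma> g *\<^sub>v (P *\<^sub>v x) = P *\<^sub>v (\<tau> g *\<^sub>v x)" if "g \<in> carrier G" "x \<in> carrier_vec k" for g x
    using that P representation_carrier[OF r\<sigma> that(1)] representation_carrier[OF r\<tau> that(1)]
      comm[OF that(1)] by (metis assoc_mult_mat_vec)
  obtain j where j: "j < k" "P *\<^sub>v unit_vec k j \<noteq> 0\<^sub>v n"
  proof -
    have "\<exists>j<k. col P j \<noteq> 0\<^sub>v n"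
    proof (rule ccontr)
      assume "\<not> ?thesis"
      then have "P = 0\<^sub>m n k"
        using P(1) by (intro mat_col_eqI) auto
      then show False using P(2) by simp
    qed
    then show ?thesis using that P(1) by (metis mult_mat_vec_unit_vec)
  qed
  let ?K = "{x \<in> carrier_vec k. P *\<^sub>v x = 0\<^sub>v n}"
  have "?K = {0\<^sub>v k} \<or> ?K = carrier_vec k"
    using \<tau>
  proof (rule irreducible_representation_subspace)
    fix g w assume "g \<in> carrier G" "w \<in> ?K"
    then show "\<tau> g *\<^sub>v w \<in> ?K"
      using commv[of g w] mult_mat_vec_zero[OF representation_carrier[OF r\<sigma>]]
        mult_mat_vec_carrier[OF representation_carrier[OF r\<tau>]] by simp
  qed (use P in \<open>auto simp: mult_mat_vec_zero mult_add_distrib_mat_vec mult_mat_vec\<close>)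
  \<comment> \<open>A nonzero column of \<open>P\<close> keeps the kernel proper, so irreducibility
    of \<open>\<tau>\<close> makes it trivial.\<close>
  moreover have "unit_vec k j \<in> carrier_vec k - ?K" using j by auto
  ultimately have ker: "?K = {0\<^sub>v k}" by blast
  let ?R = "(\<lambda>x. P *\<^sub>v x) ` carrier_vec k"
  have "?R = {0\<^sub>v n} \<or> ?R = carrier_vec n"
    using \<sigma>
  proof (rule irreducible_representation_subspace)
    fix g w assume "g \<in> carrier G" "w \<in> ?R"
    then show "\<sigma> g *\<^sub>v w \<in> ?R"
      using commv representation_carrier[OF r\<tau>] by fastforce
  next
    show "0\<^sub>v n \<in> ?R" using mult_mat_vec_zero[OF P(1)] by (metis image_eqI zero_carrier_vec)
  next
    fix v w assume "v \<in> ?R" "w \<in> ?R"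
    then obtain x y where "x \<in> carrier_vec k" "y \<in> carrier_vec k" "v = P *\<^sub>v x" "w = P *\<^sub>v y" by blast
    then show "v + w \<in> ?R"
      using P(1) by (intro image_eqI[where x = "x + y"]) (auto simp: mult_add_distrib_mat_vec)
  next
    fix c v assume "v \<in> ?R"
    then obtain x where "x \<in> carrier_vec k" "v = P *\<^sub>v x" by blast
    then show "c \<cdot>\<^sub>v v \<in> ?R"
      using P(1) by (intro image_eqI[where x = "c \<cdot>\<^sub>v x"]) (auto simp: mult_mat_vec)
  qed (use P in auto)
  then have ran: "?R = carrier_vec n" using j by auto
  \<comment> \<open>Surjectivity gives preimages of the unit vectors; taken as columns, they form a
    right inverse \<open>Q\<close>.\<close>
  have "\<exists>x. x \<in> carrier_vec k \<and> P *\<^sub>v x = unit_vec n i" for i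
    using ran unit_vec_carrier[of n i] by (metis imageE)
  then obtain q where q: "\<And>i. q i \<in> carrier_vec k" "\<And>i. P *\<^sub>v q i = unit_vec n i"
    by metis
  define Q where "Q = mat_of_cols k (map q [0..<n])"
  have Q: "Q \<in> carrier_mat k n"
    unfolding Q_def using mat_of_cols_carrier(1)[of k "map q [0..<n]"] by simp
  have colQ: "col Q i = q i" if "i < n" for i
    using that q by (simp add: Q_def)
  have PQ: "P * Q = 1\<^sub>m n"
  proof (rule mat_col_eqI)
    fix i assume "i < dim_col (1\<^sub>m n :: complex mat)"
    then show "col (P * Q) i = col (1\<^sub>m n) i"
      using col_mult2[OF P(1) Q, of i] q(2)[of i] colQ[of i] by simp
  qed (use P Q in auto)
  have QP: "Q * P = 1\<^sub>m k"
  proof (rule mat_col_eqI)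
    fix i assume i: "i < dim_col (1\<^sub>m k :: complex mat)"
    \<comment> \<open>\<open>P\<close> kills \<open>?d\<close> because \<open>P * Q * P = P\<close>;
      the trivial kernel then makes \<open>Q\<close> a left inverse as well.\<close>
    let ?d = "(Q * P) *\<^sub>v unit_vec k i - unit_vec k i"
    have "P *\<^sub>v ((Q * P) *\<^sub>v unit_vec k i) = (P * (Q * P)) *\<^sub>v unit_vec k i"
      using P(1) Q by (intro assoc_mult_mat_vec[symmetric]) auto
    also have "P * (Q * P) = P"
      using assoc_mult_mat[OF P(1) Q P(1)] PQ P(1) by simp
    finally have "P *\<^sub>v ?d = 0\<^sub>v n"
      using P(1) Q
      by (subst mult_minus_distrib_mat_vec[OF P(1)]) auto
    moreover have "?d \<in> carrier_vec k" using P(1) Q by auto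
    ultimately have "?d = 0\<^sub>v k" using ker by blast
    then have eq: "(Q * P) *\<^sub>v unit_vec k i = unit_vec k i"
      using P(1) Q by (intro eq_vecI) (auto simp: vec_eq_iff)
    show "col (Q * P) i = col (1\<^sub>m k) i"
      using eq P(1) Q i mult_mat_vec_unit_vec[of "Q * P" k k i] by simp
  qed (use P Q in auto)
  have nk: "n = k" using two_sided_inverse_imp_square[OF P(1) Q PQ QP] .
  \<comment> \<open>The isomorphism has to carry \<open>\<sigma>\<close> to \<open>\<tau>\<close>,
    while \<open>P\<close> intertwines in the other direction; hence the witness is its inverse
    \<open>Q\<close>.\<close>
  have "Q \<in> carrier (general_linear k)"
    using P(1) Q PQ QP nk by (intro general_linearI[of Q k P]) auto
  moreover have "Q * \<sigma> g = \<tau> g * Q" if g: "g \<in> carrier G" for g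
  proof -
    note S = representation_carrier[OF r\<sigma> g] and T = representation_carrier[OF r\<tau> g]
    have "Q * \<sigma> g = Q * (\<sigma> g * (P * Q))" using S Q PQ by simp
    also have "\<dots> = Q * ((\<sigma> g * P) * Q)" using S P(1) Q by (simp add: assoc_mult_mat)
    also have "\<dots> = Q * ((P * \<tau> g) * Q)" using comm[OF g] by simp
    also have "\<dots> = (Q * P) * (\<tau> g * Q)"
      using S T P(1) Q nk by (simp add: assoc_mult_mat[of _ k k _ k _ k])
    also have "\<dots> = \<tau> g * Q" using QP T Q by simp
    finally show ?thesis .
  qed
  ultimately show ?thesis
    using nk by (auto simp: isomorphic_representations_def)
qed

section \<open>Common eigenvectors\<close>

text \<open>This is \<open>q(M) v\<close>, computed by Horner's scheme on vectors. The dimension of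
  \<open>v\<close> fixes that of the zero vector at which the fold starts.\<close>

definition poly_mat_vec :: "'a::field poly \<Rightarrow> 'a mat \<Rightarrow> 'a vec \<Rightarrow> 'a vec" where
  "poly_mat_vec q M v = fold_coeffs (\<lambda>a u. a \<cdot>\<^sub>v v + M *\<^sub>v u) q (0\<^sub>v (dim_vec v))"

context
  fixes M :: "'a::field mat" and v :: "'a vec" and n :: nat
  assumes M: "M \<in> carrier_mat n n" and v: "v \<in> carrier_vec n"
begin

lemma poly_mat_vec_0: "poly_mat_vec 0 M v = 0\<^sub>v n"
  using v by (simp add: poly_mat_vec_def)

lemma poly_mat_vec_pCons: "poly_mat_vec (pCons a q) M v = a \<cdot>\<^sub>v v + M *\<^sub>v poly_mat_vec q M v"
proof (cases "a = 0 \<and> q = 0")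
  \<comment> \<open>\<open>pCons 0 0\<close> is the zero polynomial, on which the fold takes no
    step.\<close>
  case True
  then show ?thesis
    using M v mult_mat_vec_zero[OF M] by (auto simp: poly_mat_vec_0 intro!: eq_vecI)
next
  case False
  then show ?thesis by (auto simp: poly_mat_vec_def)
qed

lemma poly_mat_vec_carrier: "poly_mat_vec q M v \<in> carrier_vec n"
  using M v by (induction q) (auto simp: poly_mat_vec_0 poly_mat_vec_pCons)

lemma poly_mat_vec_add: "poly_mat_vec (p + q) M v = poly_mat_vec p M v + poly_mat_vec q M v"
proof (induction p q rule: poly_induct2)
  case (pCons a p b q)
  have "poly_mat_vec (pCons a p + pCons b q) M v
      = (a + b) \<cdot>\<^sub>v v + (M *\<^sub>v poly_mat_vec p M v + M *\<^sub>v poly_mat_vec q M v)"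
    using M poly_mat_vec_carrier
    by (simp add: poly_mat_vec_pCons pCons.IH mult_add_distrib_mat_vec[OF M])
  also have "\<dots> = poly_mat_vec (pCons a p) M v + poly_mat_vec (pCons b q) M v"
    using M v by (auto simp: poly_mat_vec_pCons algebra_simps intro!: eq_vecI)
  finally show ?case .
qed (simp add: poly_mat_vec_0)

lemma poly_mat_vec_smult: "poly_mat_vec (Polynomial.smult c q) M v = c \<cdot>\<^sub>v poly_mat_vec q M v"
proof (induction q)
  case (pCons a q)
  then show ?case
    using M v poly_mat_vec_carrier
    by (simp add: poly_mat_vec_pCons mult_mat_vec[OF M] smult_add_distrib_vec[of _ n] smult_smult_assoc)
qed (use v in \<open>auto simp: poly_mat_vec_0\<close>)

text \<open>The factor \<open>[:- c, 1:]\<close> acts as \<open>M - c\<close> on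
  \<open>q(M) v\<close>, so a vanishing product means that \<open>M\<close> scales
  \<open>q(M) v\<close> by \<open>c\<close>.\<close>

lemma poly_mat_vec_linear_factor:
  assumes "poly_mat_vec ([:- c, 1:] * q) M v = 0\<^sub>v n"
  shows "M *\<^sub>v poly_mat_vec q M v = c \<cdot>\<^sub>v poly_mat_vec q M v"
proof -
  let ?u = "poly_mat_vec q M v"
  have "poly_mat_vec ([:- c, 1:] * q) M v = (- c) \<cdot>\<^sub>v ?u + (0 \<cdot>\<^sub>v v + M *\<^sub>v ?u)"
    by (simp add: poly_mat_vec_add poly_mat_vec_smult poly_mat_vec_pCons flip: smult_minus_left)
  then have "(- c) \<cdot>\<^sub>v ?u + (0 \<cdot>\<^sub>v v + M *\<^sub>v ?u) = 0\<^sub>v n"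
    using assms by simp
  then have "((- c) \<cdot>\<^sub>v ?u + (0 \<cdot>\<^sub>v v + M *\<^sub>v ?u)) $ i = 0" if "i < n" for i
    using that by simp
  then show ?thesis
    using M v poly_mat_vec_carrier[of q]
    by (intro eq_vecI) (auto simp del: index_mult_mat_vec)
qed

text \<open>A matrix commuting with \<open>M\<close> commutes with \<open>q(M)\<close>. Eigenvalues
  already found for other matrices therefore survive the passage from \<open>v\<close> to
  \<open>q(M) v\<close>.\<close>

lemma poly_mat_vec_eigenvector:
  assumes N: "N \<in> carrier_mat n n" and "N * M = M * N" and "N *\<^sub>v v = d \<cdot>\<^sub>v v"
  shows "N *\<^sub>v poly_mat_vec q M v = d \<cdot>\<^sub>v poly_mat_vec q M v"
proof (induction q)
  case 0
  show ?case using mult_mat_vec_zero[OF N] by (auto simp: poly_mat_vec_0)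
next
  case (pCons a q)
  let ?u = "poly_mat_vec q M v"
  have u: "?u \<in> carrier_vec n" by (rule poly_mat_vec_carrier)
  have "N *\<^sub>v (M *\<^sub>v ?u) = M *\<^sub>v (N *\<^sub>v ?u)"
    using assms(2) assoc_mult_mat_vec[OF N M u] assoc_mult_mat_vec[OF M N u] by simp
  also have "\<dots> = d \<cdot>\<^sub>v (M *\<^sub>v ?u)"
    using pCons.IH u by (simp add: mult_mat_vec[OF M])
  finally have "N *\<^sub>v (a \<cdot>\<^sub>v v + M *\<^sub>v ?u) = a \<cdot>\<^sub>v (d \<cdot>\<^sub>v v) + d \<cdot>\<^sub>v (M *\<^sub>v ?u)"
    using u M v assms(3) by (simp add: mult_add_distrib_mat_vec[OF N] mult_mat_vec[OF N])
  also have "\<dots> = d \<cdot>\<^sub>v (a \<cdot>\<^sub>v v + M *\<^sub>v ?u)"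
    using u M v by (auto intro!: eq_vecI simp: algebra_simps)
  finally show ?case by (simp add: poly_mat_vec_pCons)
qed

end

text \<open>The vectors obtained from \<open>v\<close> by powers of \<open>M\<close> lie in a finite
  set, so two of them coincide and some nonzero polynomial annihilates \<open>v\<close>. One of
  least degree has a linear factor over the complex numbers; its cofactor, applied to
  \<open>v\<close>, is nonzero by minimality and is an eigenvector of \<open>M\<close>.\<close>

lemma eigenvector_refinement:
  fixes F :: "complex mat set"
  assumes "finite F" "F \<subseteq> carrier_mat n n" "1\<^sub>m n \<in> F" and M: "M \<in> F"
    and closed: "\<And>N. N \<in> F \<Longrightarrow> M * N \<in> F"
    and v: "v \<in> carrier_vec n" "v \<noteq> 0\<^sub>v n"
  obtains w c where "w \<in> carrier_vec n" "w \<noteq> 0\<^sub>v n" "M *\<^sub>v w = c \<cdot>\<^sub>v w"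
    "\<And>N d. N \<in> carrier_mat n n \<Longrightarrow> N * M = M * N \<Longrightarrow> N *\<^sub>v v = d \<cdot>\<^sub>v v \<Longrightarrow> N *\<^sub>v w = d \<cdot>\<^sub>v w"
proof -
  have Mc: "M \<in> carrier_mat n n" using assms by auto
  let ?p = "\<lambda>q. poly_mat_vec q M v"
  have orbit: "?p (monom 1 k) \<in> (\<lambda>N. N *\<^sub>v v) ` F" for k
  proof (induction k)
    case 0
    have "?p (monom 1 0) = 1\<^sub>m n *\<^sub>v v"
      using v mult_mat_vec_zero[OF Mc] by (simp add: monom_0 poly_mat_vec_pCons[OF Mc v(1)] poly_mat_vec_0[OF Mc v(1)])
    then show ?case using assms(3) by blast
  next
    case (Suc k)
    then obtain N where N: "N \<in> F" "?p (monom 1 k) = N *\<^sub>v v" by blast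
    have "?p (monom 1 (Suc k)) = M *\<^sub>v (N *\<^sub>v v)"
      using N v Mc assms(2) by (auto simp: monom_Suc poly_mat_vec_pCons[OF Mc v(1)] intro!: eq_vecI)
    also have "\<dots> = (M * N) *\<^sub>v v"
      using assoc_mult_mat_vec[OF Mc _ v(1)] N(1) assms(2) by auto
    finally show ?case using closed[OF N(1)] by blast
  qed
  have "\<not> inj (\<lambda>k. ?p (monom 1 k))"
  proof
    assume "inj (\<lambda>k. ?p (monom 1 k))"
    moreover have "finite (range (\<lambda>k. ?p (monom 1 k)))"
      by (rule finite_subset[of _ "(\<lambda>N. N *\<^sub>v v) ` F"]) (use orbit assms(1) in auto)
    ultimately show False using finite_imageD infinite_UNIV_nat by blast
  qed
  then obtain i j where ij: "i \<noteq> j" "?p (monom 1 i) = ?p (monom 1 j)"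
    unfolding inj_def by blast
  define q0 :: "complex poly" where "q0 = monom 1 i + Polynomial.smult (-1) (monom 1 j)"
  have "coeff q0 i = 1" using ij(1) by (simp add: q0_def)
  then have "q0 \<noteq> 0" by auto
  moreover have "?p q0 = 0\<^sub>v n"
    using poly_mat_vec_carrier[OF Mc v(1), of "monom 1 j"]
    unfolding q0_def poly_mat_vec_add[OF Mc v(1)] poly_mat_vec_smult[OF Mc v(1)] ij(2)
    by (auto intro!: eq_vecI)
  ultimately have ex: "\<exists>q. q \<noteq> 0 \<and> ?p q = 0\<^sub>v n" by blast
  obtain q where q: "q \<noteq> 0" "?p q = 0\<^sub>v n"
    and least: "\<And>r. r \<noteq> 0 \<Longrightarrow> ?p r = 0\<^sub>v n \<Longrightarrow> degree q \<le> degree r"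
    using ex_has_least_nat[of "\<lambda>q. q \<noteq> 0 \<and> ?p q = 0\<^sub>v n" _ degree] ex by blast
  \<comment> \<open>A nonzero constant kills only the zero vector, so the minimal annihilator has
    positive degree and hence a complex root.\<close>
  have "degree q \<noteq> 0"
  proof
    assume "degree q = 0"
    then obtain a where a: "q = [:a:]" by (rule degree_eq_zeroE)
    then have "a \<cdot>\<^sub>v v = 0\<^sub>v n"
      using q(2) v(1) mult_mat_vec_zero[OF Mc]
      by (simp add: poly_mat_vec_pCons[OF Mc v(1)] poly_mat_vec_0[OF Mc v(1)])
    moreover have "a \<noteq> 0" using a q(1) by simp
    ultimately have "v = 0\<^sub>v n"
      using v(1) by (auto simp: vec_eq_iff)
    then show False using v(2) by simp
  qed
  then have "\<not> constant (poly q)" by (simp add: constant_degree)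
  then obtain c where "poly q c = 0" using fundamental_theorem_of_algebra by blast
  then obtain r where r: "q = [:- c, 1:] * r" by (auto simp: poly_eq_0_iff_dvd)
  have "r \<noteq> 0" using q(1) r by auto
  then have "degree r < degree q" unfolding r by (subst degree_mult_eq) auto
  then have "?p r \<noteq> 0\<^sub>v n" using least[OF \<open>r \<noteq> 0\<close>] by linarith
  moreover have "M *\<^sub>v ?p r = c \<cdot>\<^sub>v ?p r"
    using q(2) unfolding r by (rule poly_mat_vec_linear_factor[OF Mc v(1)])
  ultimately show thesis
    using poly_mat_vec_eigenvector[OF Mc v(1)]
    by (intro that[OF poly_mat_vec_carrier[OF Mc v(1)]])
qed

text \<open>The matrices are treated one after the other: each refinement yields an eigenvector of
  the new matrix, and commutativity preserves the eigenvalues of the earlier ones.\<close>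

lemma common_eigenvector:
  fixes F :: "complex mat set"
  assumes F: "finite F" "F \<subseteq> carrier_mat n n" "1\<^sub>m n \<in> F" 
    and closed: "\<And>M N. M \<in> F \<Longrightarrow> N \<in> F \<Longrightarrow> M * N \<in> F"
    and comm: "\<And>M N. M \<in> F \<Longrightarrow> N \<in> F \<Longrightarrow> M * N = N * M"
    and "0 < n"
  obtains v where "v \<in> carrier_vec n" "v \<noteq> 0\<^sub>v n" "\<And>M. M \<in> F \<Longrightarrow> \<exists>c. M *\<^sub>v v = c \<cdot>\<^sub>v v"
proof -
  \<comment> \<open>The induction runs over subsets \<open>S\<close> while \<open>F\<close> stays
    fixed, since every refinement step uses closure under multiplication.\<close>
  have "\<exists>v. v \<in> carrier_vec n \<and> v \<noteq> 0\<^sub>v n \<and> (\<forall>M\<in>S. \<exists>c. M *\<^sub>v v = c \<cdot>\<^sub>v v)"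
    if "finite S" "S \<subseteq> F" for S
    using that
  proof (induction S)
    case empty
    have "unit_vec n 0 \<noteq> (0\<^sub>v n :: complex vec)" using \<open>0 < n\<close> by simp
    then show ?case by (intro exI[of _ "unit_vec n 0"]) simp
  next
    case (insert M S)
    then obtain v where v: "v \<in> carrier_vec n" "v \<noteq> 0\<^sub>v n" "\<forall>N\<in>S. \<exists>c. N *\<^sub>v v = c \<cdot>\<^sub>v v"
      by blast
    have "M \<in> F" using insert by blast
    obtain w c where w: "w \<in> carrier_vec n" "w \<noteq> 0\<^sub>v n" "M *\<^sub>v w = c \<cdot>\<^sub>v w"
      and *: "\<And>N d. N \<in> carrier_mat n n \<Longrightarrow> N * M = M * N \<Longrightarrow> N *\<^sub>v v = d \<cdot>\<^sub>v v \<Longrightarrow> N *\<^sub>v w = d \<cdot>\<^sub>v w"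
      using eigenvector_refinement[OF F \<open>M \<in> F\<close> closed[OF \<open>M \<in> F\<close>] v(1,2)] by blast
    have "\<exists>d. N *\<^sub>v w = d \<cdot>\<^sub>v w" if "N \<in> S" for N
      using that v(3) * comm[OF _ \<open>M \<in> F\<close>] F(2) insert.prems by blast
    then show ?case using w by blast
  qed
  from this[OF F(1) order.refl] obtain v
    where "v \<in> carrier_vec n" "v \<noteq> 0\<^sub>v n" "\<forall>M\<in>F. \<exists>c. M *\<^sub>v v = c \<cdot>\<^sub>v v"
    by (elim exE conjE)
  then show thesis by (intro that[of v]) simp_all
qed

section \<open>Irreducible representations of the wreath product\<close>

text \<open>The triple \<open>(a, b, s)\<close> is the base element \<open>(a, b)\<close>, followed
  by the swap \<open>z\<close> if \<open>s\<close> holds. Moving \<open>z\<close> past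
  \<open>(c, d)\<close> exchanges the coordinates, and negating the flag encodes that
  \<open>z\<close> is an involution.\<close>

definition wreath_c2 :: "('h::ab_group_add \<times> 'h \<times> bool) monoid" where
  "wreath_c2 = \<lparr>carrier = UNIV,
     monoid.mult = (\<lambda>(a, b, s) (c, d, t). if s then (a + d, b + c, \<not> t) else (a + c, b + d, t)),
     one = (0, 0, False)\<rparr>"

lemma wreath_c2_simps [simp]:
  "carrier wreath_c2 = UNIV"
  "(a, b, False) \<otimes>\<^bsub>wreath_c2\<^esub> (c, d, t) = (a + c, b + d, t)"
  "(a, b, True) \<otimes>\<^bsub>wreath_c2\<^esub> (c, d, t) = (a + d, b + c, \<not> t)"
  "\<one>\<^bsub>wreath_c2\<^esub> = (0, 0, False)"
  by (simp_all add: wreath_c2_def)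

lemma group_wreath_c2: "group (wreath_c2 :: ('h::ab_group_add \<times> 'h \<times> bool) monoid)"
proof (rule groupI)
  fix x y z :: "'h \<times> 'h \<times> bool"
  obtain a b s where x: "x = (a, b, s)" by (cases x)
  obtain c d t where y: "y = (c, d, t)" by (cases y)
  obtain e f u where z: "z = (e, f, u)" by (cases z)
  show "x \<otimes>\<^bsub>wreath_c2\<^esub> y \<otimes>\<^bsub>wreath_c2\<^esub> z = x \<otimes>\<^bsub>wreath_c2\<^esub> (y \<otimes>\<^bsub>wreath_c2\<^esub> z)"
    unfolding x y z by (cases s; cases t) (simp_all add: add.assoc)
  show "\<one>\<^bsub>wreath_c2\<^esub> \<otimes>\<^bsub>wreath_c2\<^esub> x = x"
    by (simp add: x)
  show "\<exists>y\<in>carrier wreath_c2. y \<otimes>\<^bsub>wreath_c2\<^esub> x = \<one>\<^bsub>wreath_c2\<^esub>"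
    by (rule bexI[of _ "if s then (- b, - a, True) else (- a, - b, False)"]) (simp_all add: x)
qed auto

text \<open>The inverse of \<open>(a, b) z\<close> is \<open>z (- a, - b)\<close>, which equals
  \<open>(- b, - a) z\<close>.\<close>

lemma wreath_c2_inv [simp]:
  fixes a b :: "'h::ab_group_add"
  shows "inv\<^bsub>wreath_c2\<^esub> (a, b, False) = (- a, - b, False)"
    and "inv\<^bsub>wreath_c2\<^esub> (a, b, True) = (- b, - a, True)"
proof -
  interpret group "wreath_c2 :: ('h \<times> 'h \<times> bool) monoid" by (rule group_wreath_c2)
  show "inv\<^bsub>wreath_c2\<^esub> (a, b, False) = (- a, - b, False)"
    and "inv\<^bsub>wreath_c2\<^esub> (a, b, True) = (- b, - a, True)"
    by (rule inv_equality; simp)+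
qed

section \<open>Characters and the two families of irreducible representations\<close>

text \<open>The value at 0 excludes the zero function, which is multiplicative too.\<close>

definition character :: "('h::ab_group_add \<Rightarrow> complex) \<Rightarrow> bool" where
  "character \<alpha> \<longleftrightarrow> \<alpha> 0 = 1 \<and> (\<forall>x y. \<alpha> (x + y) = \<alpha> x * \<alpha> y)"

lemma character_0: "character \<alpha> \<Longrightarrow> \<alpha> 0 = 1"
  and character_add: "character \<alpha> \<Longrightarrow> \<alpha> (x + y) = \<alpha> x * \<alpha> y"
  by (auto simp: character_def)

text \<open>The two extensions of the base character \<open>\<alpha> \<otimes> \<alpha>\<close>
  differ in the sign by which the swap acts; \<open>u\<close> selects it.\<close>

definition linear_rep :: "('h \<Rightarrow> complex) \<Rightarrow> bool \<Rightarrow> 'h \<times> 'h \<times> bool \<Rightarrow> complex mat" where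
  "linear_rep \<alpha> u = (\<lambda>(a, b, s). mat 1 1 (\<lambda>_. \<alpha> a * \<alpha> b * (if s \<and> u then - 1 else 1)))"

text \<open>The representation induced from the character \<open>(a, b) \<mapsto> \<alpha> a * \<beta> b\<close> of the base group.\<close>

definition induced_rep :: "('h \<Rightarrow> complex) \<Rightarrow> ('h \<Rightarrow> complex) \<Rightarrow> 'h \<times> 'h \<times> bool \<Rightarrow> complex mat" where
  "induced_rep \<alpha> \<beta> = (\<lambda>(a, b, s). mat 2 2 (\<lambda>(i, j).
     if (i = j) = s then 0 else if i = 0 then \<alpha> a * \<beta> b else \<beta> a * \<alpha> b))"

lemma linear_rep_carrier: "linear_rep \<alpha> u g \<in> carrier_mat 1 1"
  by (auto simp: linear_rep_def split: prod.split)

lemma induced_rep_carrier: "induced_rep \<alpha> \<beta> g \<in> carrier_mat 2 2"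
  by (auto simp: induced_rep_def split: prod.split)

lemma linear_rep_irreducible:
  fixes \<alpha> :: "'h::ab_group_add \<Rightarrow> complex"
  assumes "character \<alpha>"
  shows "irreducible_representation wreath_c2 1 (linear_rep \<alpha> u)"
  unfolding irreducible_representation_def subspace_module_vec_iff
proof (intro conjI allI impI)
  show "representation wreath_c2 1 (linear_rep \<alpha> u)"
  proof (rule representationI[OF group_wreath_c2 linear_rep_carrier])
    fix g h :: "'h \<times> 'h \<times> bool"
    obtain a b s where x: "g = (a, b, s)" by (cases g)
    obtain c d t where y: "h = (c, d, t)" by (cases h)
    show "linear_rep \<alpha> u (g \<otimes>\<^bsub>wreath_c2\<^esub> h) = linear_rep \<alpha> u g * linear_rep \<alpha> u h"
      unfolding x y using assms
      by (cases s; cases t; intro eq_matI) (simp_all add: linear_rep_def scalar_prod_def character_add)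
  qed (use assms in \<open>auto simp: linear_rep_def character_0 intro!: eq_matI\<close>)
next
  fix W :: "complex vec set"
  assume "(W \<subseteq> carrier_vec 1 \<and> 0\<^sub>v 1 \<in> W \<and> (\<forall>v\<in>W. \<forall>w\<in>W. v + w \<in> W) \<and> (\<forall>c. \<forall>v\<in>W. c \<cdot>\<^sub>v v \<in> W)) \<and>
    (\<forall>g\<in>carrier wreath_c2. \<forall>w\<in>W. linear_rep \<alpha> u g *\<^sub>v w \<in> W)"
  then have W: "W \<subseteq> carrier_vec 1" "0\<^sub>v 1 \<in> W" "\<And>c v. v \<in> W \<Longrightarrow> c \<cdot>\<^sub>v v \<in> W" by auto
  show "W = {0\<^sub>v 1} \<or> W = carrier_vec 1"
  proof (rule disjCI)
    assume "W \<noteq> carrier_vec 1"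
    have "w = 0\<^sub>v 1" if "w \<in> W" for w
    proof (rule ccontr)
      assume "w \<noteq> 0\<^sub>v 1"
      then have "w $ 0 \<noteq> 0" using that W(1) by (auto simp: vec_eq_iff)
      then have "x = (x $ 0 / w $ 0) \<cdot>\<^sub>v w" if "x \<in> carrier_vec 1" for x
        using that \<open>w \<in> W\<close> W(1) by (intro eq_vecI) auto
      then have "carrier_vec 1 \<subseteq> W" using W(3)[OF that] by (metis subsetI)
      then show False using W(1) \<open>W \<noteq> carrier_vec 1\<close> by blast
    qed
    then show "W = {0\<^sub>v 1}" using W(2) by blast
  qed
qed simp

definition vec2 :: "'a \<Rightarrow> 'a \<Rightarrow> 'a vec" where
  "vec2 x y = vec 2 (\<lambda>i. if i = 0 then x else y)"

lemma vec2_carrier [simp]: "vec2 x y \<in> carrier_vec 2"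
  by (simp add: vec2_def)

lemma vec2_eta: "v \<in> carrier_vec 2 \<Longrightarrow> v = vec2 (v $ 0) (v $ 1)"
  by (intro eq_vecI) (auto simp: vec2_def less_2_cases_iff)

lemma vec2_arith:
  "vec2 x y + vec2 x' y' = vec2 (x + x' :: 'a::semiring_1) (y + y')"
  "c \<cdot>\<^sub>v vec2 x y = vec2 (c * x :: 'a::semiring_1) (c * y)"
  by (auto simp: vec2_def)

lemma vec2_0: "0\<^sub>v 2 = vec2 0 0"
  by (auto simp: vec2_def)

lemma induced_rep_mult_vec:
  "induced_rep \<alpha> \<beta> (a, b, False) *\<^sub>v vec2 x y = vec2 (\<alpha> a * \<beta> b * x) (\<beta> a * \<alpha> b * y)"
  "induced_rep \<alpha> \<beta> (a, b, True) *\<^sub>v vec2 x y = vec2 (\<alpha> a * \<beta> b * y) (\<beta> a * \<alpha> b * x)"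
  by (rule eq_vecI; auto simp: induced_rep_def vec2_def scalar_prod_def less_2_cases_iff numeral_2_eq_2)+

lemma induced_rep_representation:
  fixes \<alpha> \<beta> :: "'h::ab_group_add \<Rightarrow> complex"
  assumes "character \<alpha>" "character \<beta>"
  shows "representation wreath_c2 2 (induced_rep \<alpha> \<beta>)"
proof (rule representationI[OF group_wreath_c2 induced_rep_carrier])
  fix g h :: "'h \<times> 'h \<times> bool"
  obtain a b s where x: "g = (a, b, s)" by (cases g)
  obtain c d t where y: "h = (c, d, t)" by (cases h)
  show "induced_rep \<alpha> \<beta> (g \<otimes>\<^bsub>wreath_c2\<^esub> h) = induced_rep \<alpha> \<beta> g * induced_rep \<alpha> \<beta> h"
    unfolding x y using assms
    by (cases s; cases t; intro eq_matI)
       (auto simp: induced_rep_def scalar_prod_def character_add less_2_cases_iff numeral_2_eq_2)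
qed (use assms in \<open>auto simp: induced_rep_def character_0 less_2_cases_iff intro!: eq_matI\<close>)

text \<open>Where \<open>\<alpha> a\<close> and \<open>\<beta> a\<close> differ, the operator of
  \<open>(a, 0)\<close> minus \<open>\<beta> a\<close> erases the second coordinate and keeps a
  nonzero multiple of the first. Hence an invariant subspace with a vector of nonzero first
  coordinate contains one basis vector, and by the swap also the other; the swap likewise handles
  vectors whose first coordinate is zero.\<close>

lemma induced_rep_irreducible:
  fixes \<alpha> \<beta> :: "'h::ab_group_add \<Rightarrow> complex"
  assumes "character \<alpha>" "character \<beta>" "\<alpha> \<noteq> \<beta>"
  shows "irreducible_representation wreath_c2 2 (induced_rep \<alpha> \<beta>)"
  unfolding irreducible_representation_def subspace_module_vec_iff
proof (intro conjI allI impI)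
  show "representation wreath_c2 2 (induced_rep \<alpha> \<beta>)"
    using assms by (intro induced_rep_representation)
next
  fix W :: "complex vec set"
  assume "(W \<subseteq> carrier_vec 2 \<and> 0\<^sub>v 2 \<in> W \<and> (\<forall>v\<in>W. \<forall>w\<in>W. v + w \<in> W) \<and> (\<forall>c. \<forall>v\<in>W. c \<cdot>\<^sub>v v \<in> W)) \<and>
    (\<forall>g\<in>carrier wreath_c2. \<forall>w\<in>W. induced_rep \<alpha> \<beta> g *\<^sub>v w \<in> W)"
  then have W: "W \<subseteq> carrier_vec 2" "0\<^sub>v 2 \<in> W"
    and add: "\<And>v w. v \<in> W \<Longrightarrow> w \<in> W \<Longrightarrow> v + w \<in> W"
    and scale: "\<And>c v. v \<in> W \<Longrightarrow> c \<cdot>\<^sub>v v \<in> W"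
    and inv: "\<And>g w. w \<in> W \<Longrightarrow> induced_rep \<alpha> \<beta> g *\<^sub>v w \<in> W" by auto
  obtain a where a: "\<alpha> a \<noteq> \<beta> a" using assms(3) by blast
  note [simp] = character_0[OF assms(1)] character_0[OF assms(2)]
  have swap: "vec2 y x \<in> W" if "vec2 x y \<in> W" for x y
    using inv[OF that, of "(0, 0, True)"] by (simp add: induced_rep_mult_vec)
  have full: "W = carrier_vec 2" if w: "vec2 x y \<in> W" "x \<noteq> 0" for x y
  proof -
    have "induced_rep \<alpha> \<beta> (a, 0, False) *\<^sub>v vec2 x y + (- \<beta> a) \<cdot>\<^sub>v vec2 x y \<in> W"
      using w inv scale add by blast
    then have "vec2 ((\<alpha> a - \<beta> a) * x) 0 \<in> W"
      by (simp add: induced_rep_mult_vec vec2_arith algebra_simps)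
    from scale[OF this, of "1 / ((\<alpha> a - \<beta> a) * x)"] have e1: "vec2 1 0 \<in> W"
      using a w(2) by (simp add: vec2_arith)
    have "v \<in> W" if "v \<in> carrier_vec 2" for v
    proof -
      have "v $ 0 \<cdot>\<^sub>v vec2 1 0 + v $ 1 \<cdot>\<^sub>v vec2 0 1 \<in> W"
        using e1 swap[OF e1] scale add by blast
      then show ?thesis
        using vec2_eta[OF that] by (simp add: vec2_arith)
    qed
    then show ?thesis using W(1) by blast
  qed
  show "W = {0\<^sub>v 2} \<or> W = carrier_vec 2"
  proof (rule disjCI)
    assume "W \<noteq> carrier_vec 2"
    then have "vec2 x y \<in> W \<Longrightarrow> vec2 x y = 0\<^sub>v 2" for x y
      using full swap by (cases "x = 0"; cases "y = 0") (auto simp: vec2_0)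
    then have "w = 0\<^sub>v 2" if "w \<in> W" for w
      using that W(1) vec2_eta by (metis subsetD)
    then show "W = {0\<^sub>v 2}" using W(2) by blast
  qed
qed simp

section \<open>Isomorphisms within each family\<close>

text \<open>The nonzero entry of a 1 by 1 intertwiner cancels, so the two matrix functions agree;
  base elements recover the character and the swap recovers the sign.\<close>

lemma linear_rep_isomorphic_imp_eq:
  assumes "character \<alpha>" "character \<alpha>'"
    and "isomorphic_representations wreath_c2 1 (linear_rep \<alpha> u) 1 (linear_rep \<alpha>' u')"
  shows "\<alpha> = \<alpha>' \<and> u = u'"
proof -
  obtain P where P: "P \<in> carrier (general_linear 1)"
    "\<And>g. P * linear_rep \<alpha> u g = linear_rep \<alpha>' u' g * P"
    using assms(3) by (auto simp: isomorphic_representations_def)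
  obtain Q where Q: "P \<in> carrier_mat 1 1" "Q \<in> carrier_mat 1 1" "P * Q = 1\<^sub>m 1"
    using P(1) by (rule general_linearE)
  have "(P * Q) $$ (0, 0) = 1" using Q(3) by simp
  then have p: "P $$ (0, 0) \<noteq> 0" using Q(1,2) by (auto simp: scalar_prod_def)
  have eq: "linear_rep \<alpha> u g $$ (0, 0) = linear_rep \<alpha>' u' g $$ (0, 0)" for g
  proof -
    have "(P * linear_rep \<alpha> u g) $$ (0, 0) = (linear_rep \<alpha>' u' g * P) $$ (0, 0)"
      using P(2) by simp
    then show ?thesis
      using Q(1) p linear_rep_carrier[of \<alpha> u g] linear_rep_carrier[of \<alpha>' u' g]
      by (auto simp: scalar_prod_def)
  qed
  have "\<alpha> a = \<alpha>' a" for a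
    using eq[of "(a, 0, False)"] assms(1,2) by (simp add: linear_rep_def character_0)
  moreover have "u = u'"
    using eq[of "(0, 0, True)"] assms(1,2)
    by (auto simp: linear_rep_def character_0 split: if_splits)
  ultimately show ?thesis by blast
qed

text \<open>The first column of the intertwiner has a nonzero entry. Comparing that entry on base
  elements identifies \<open>\<alpha> \<otimes> \<beta>\<close> with
  \<open>\<gamma> \<otimes> \<delta>\<close> or \<open>\<delta> \<otimes> \<gamma>\<close>, and
  setting one argument to 0 separates the factors.\<close>

lemma induced_rep_isomorphic_imp_eq:
  assumes \<alpha>: "character \<alpha>" and \<beta>: "character \<beta>" and \<gamma>: "character \<gamma>" and \<delta>: "character \<delta>"
    and "isomorphic_representations wreath_c2 2 (induced_rep \<alpha> \<beta>) 2 (induced_rep \<gamma> \<delta>)"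
  shows "\<alpha> = \<gamma> \<and> \<beta> = \<delta> \<or> \<alpha> = \<delta> \<and> \<beta> = \<gamma>"
proof -
  obtain P where P: "P \<in> carrier (general_linear 2)"
    "\<And>g. P * induced_rep \<alpha> \<beta> g = induced_rep \<gamma> \<delta> g * P"
    using assms(5) by (auto simp: isomorphic_representations_def)
  obtain Q where Q: "P \<in> carrier_mat 2 2" "Q \<in> carrier_mat 2 2" "Q * P = 1\<^sub>m 2"
    using P(1) by (rule general_linearE)
  have "(Q * P) $$ (0, 0) = 1" using Q(3) by simp
  then have p: "P $$ (0, 0) \<noteq> 0 \<or> P $$ (1, 0) \<noteq> 0"
    using Q(1,2) by (auto simp: scalar_prod_def numeral_2_eq_2)
  have eq0: "P $$ (0, 0) * (\<alpha> a * \<beta> b) = P $$ (0, 0) * (\<gamma> a * \<delta> b)"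
    and eq1: "P $$ (1, 0) * (\<alpha> a * \<beta> b) = P $$ (1, 0) * (\<delta> a * \<gamma> b)" for a b
  proof -
    have "(P * induced_rep \<alpha> \<beta> (a, b, False)) $$ (i, 0) = (induced_rep \<gamma> \<delta> (a, b, False) * P) $$ (i, 0)" for i
      using P(2) by simp
    from this[of 0] this[of 1]
    show "P $$ (0, 0) * (\<alpha> a * \<beta> b) = P $$ (0, 0) * (\<gamma> a * \<delta> b)"
      and "P $$ (1, 0) * (\<alpha> a * \<beta> b) = P $$ (1, 0) * (\<delta> a * \<gamma> b)"
      using Q(1) by (simp_all add: scalar_prod_def induced_rep_def numeral_2_eq_2 mult_ac)
  qed
  from p show ?thesis
  proof
    assume "P $$ (0, 0) \<noteq> 0"
    then have "\<alpha> a * \<beta> b = \<gamma> a * \<delta> b" for a b using eq0 by simp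
    from this[of _ 0] this[of 0] show ?thesis
      using assms(1-4) by (auto simp: character_0)
  next
    assume "P $$ (1, 0) \<noteq> 0"
    then have "\<alpha> a * \<beta> b = \<delta> a * \<gamma> b" for a b using eq1 by simp
    from this[of _ 0] this[of 0] show ?thesis
      using assms(1-4) by (auto simp: character_0)
  qed
qed

lemma smult_vec_right_cancel:
  fixes v :: "'a::field vec"
  assumes "c \<cdot>\<^sub>v v = d \<cdot>\<^sub>v v" "v \<in> carrier_vec n" "v \<noteq> 0\<^sub>v n"
  shows "c = d"
proof -
  obtain i where i: "i < n" "v $ i \<noteq> 0" using assms(2,3) by (auto simp: vec_eq_iff)
  have "(c \<cdot>\<^sub>v v) $ i = (d \<cdot>\<^sub>v v) $ i" using assms(1) by simp
  then show ?thesis using i assms(2) by simp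
qed

section \<open>Weight vectors of the base group\<close>

text \<open>These are the weight vectors for \<open>\<alpha> \<otimes> \<beta>\<close> in the
  restriction of \<open>\<sigma>\<close> to the base group.\<close>

definition base_eigenvector ::
  "nat \<Rightarrow> ('h \<times> 'h \<times> bool \<Rightarrow> complex mat) \<Rightarrow> ('h \<Rightarrow> complex) \<Rightarrow> ('h \<Rightarrow> complex) \<Rightarrow> complex vec \<Rightarrow> bool" where
  "base_eigenvector n \<sigma> \<alpha> \<beta> v \<longleftrightarrow> v \<in> carrier_vec n \<and> v \<noteq> 0\<^sub>v n \<and>
     (\<forall>a b. \<sigma> (a, b, False) *\<^sub>v v = (\<alpha> a * \<beta> b) \<cdot>\<^sub>v v)"

context
  fixes n :: nat and \<sigma> :: "'h::{ab_group_add, finite} \<times> 'h \<times> bool \<Rightarrow> complex mat"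
  assumes rep: "representation wreath_c2 n \<sigma>"
begin

lemma rep_carrier: "\<sigma> g \<in> carrier_mat n n"
  using representation_carrier[OF rep] by simp

lemma rep_mult_vec:
  assumes "v \<in> carrier_vec n"
  shows "\<sigma> g *\<^sub>v (\<sigma> h *\<^sub>v v) = \<sigma> (g \<otimes>\<^bsub>wreath_c2\<^esub> h) *\<^sub>v v"
  using assoc_mult_mat_vec[OF rep_carrier rep_carrier assms] representation_mult[OF rep, of g h]
  by simp

text \<open>The image of the base is a finite commuting family closed under products, so it has a
  common eigenvector. Its eigenvalue is multiplicative in \<open>(a, b)\<close> and hence splits
  into a factor for \<open>(a, 0)\<close> and one for \<open>(0, b)\<close>.\<close>

lemma base_eigenvector_exists:
  assumes "0 < n"
  obtains v \<alpha> \<beta> where "character \<alpha>" "character \<beta>" "base_eigenvector n \<sigma> \<alpha> \<beta> v"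
proof -
  let ?F = "range (\<lambda>(a, b). \<sigma> (a, b, False))"
  have one: "\<sigma> (0, 0, False) = 1\<^sub>m n"
    using representation_one[OF group_wreath_c2 rep] by simp
  have mult: "\<sigma> (a, b, False) * \<sigma> (c, d, False) = \<sigma> (a + c, b + d, False)" for a b c d
    using representation_mult[OF rep, of "(a, b, False)" "(c, d, False)"] by simp
  obtain v where v: "v \<in> carrier_vec n" "v \<noteq> 0\<^sub>v n" "\<And>M. M \<in> ?F \<Longrightarrow> \<exists>c. M *\<^sub>v v = c \<cdot>\<^sub>v v"
  proof (rule common_eigenvector[of ?F n])
    have "\<sigma> (0, 0, False) \<in> ?F" by (rule range_eqI[where x = "(0, 0)"]) simp
    then show "1\<^sub>m n \<in> ?F" by (simp add: one)
  next
    fix M N assume "M \<in> ?F" "N \<in> ?F"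
    then obtain a b c d where MN: "M = \<sigma> (a, b, False)" "N = \<sigma> (c, d, False)" by auto
    have "\<sigma> (a + c, b + d, False) \<in> ?F" by (rule range_eqI[where x = "(a + c, b + d)"]) simp
    then show "M * N \<in> ?F" by (simp add: MN mult)
    show "M * N = N * M" by (simp add: MN mult add.commute)
  qed (use rep_carrier assms in auto)
  have "\<exists>c. \<sigma> (a, b, False) *\<^sub>v v = c \<cdot>\<^sub>v v" for a b
    by (rule v(3)) (rule range_eqI[where x = "(a, b)"], simp)
  then obtain \<chi> where \<chi>: "\<And>a b. \<sigma> (a, b, False) *\<^sub>v v = \<chi> a b \<cdot>\<^sub>v v" by metis
  have \<chi>_add: "\<chi> (a + c) (b + d) = \<chi> a b * \<chi> c d" for a b c d
  proof (rule smult_vec_right_cancel[OF _ v(1,2)])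
    have "\<sigma> (a, b, False) *\<^sub>v (\<sigma> (c, d, False) *\<^sub>v v) = (\<chi> c d * \<chi> a b) \<cdot>\<^sub>v v"
      using v(1) by (simp add: \<chi> mult_mat_vec[OF rep_carrier] smult_smult_assoc)
    then show "\<chi> (a + c) (b + d) \<cdot>\<^sub>v v = (\<chi> a b * \<chi> c d) \<cdot>\<^sub>v v"
      using rep_mult_vec[OF v(1), of "(a, b, False)" "(c, d, False)"] \<chi> by (simp add: mult.commute)
  qed
  have \<chi>_0: "\<chi> 0 0 = 1"
    by (rule smult_vec_right_cancel[OF _ v(1,2)]) (use \<chi>[of 0 0] one v(1) in simp)
  show thesis
  proof (rule that[of "\<lambda>a. \<chi> a 0" "\<chi> 0" v])
    show "character (\<lambda>a. \<chi> a 0)" "character (\<chi> 0)"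
      using \<chi>_add[where b = 0 and d = 0] \<chi>_add[where a = 0 and c = 0] \<chi>_0
      by (simp_all add: character_def)
    have "\<chi> a b = \<chi> a 0 * \<chi> 0 b" for a b
      using \<chi>_add[of a 0 0 b] by simp
    then have "\<sigma> (a, b, False) *\<^sub>v v = (\<chi> a 0 * \<chi> 0 b) \<cdot>\<^sub>v v" for a b
      using \<chi>[of a b] by metis
    then show "base_eigenvector n \<sigma> (\<lambda>a. \<chi> a 0) (\<chi> 0) v"
      using v(1,2) by (simp add: base_eigenvector_def)
  qed
qed

text \<open>Conjugation by the swap turns \<open>(a, b)\<close> into \<open>(b, a)\<close>, so
  applying the swap exchanges the two characters of the weight.\<close>

lemma base_eigenvector_swap:
  assumes "base_eigenvector n \<sigma> \<alpha> \<beta> v"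
  shows "base_eigenvector n \<sigma> \<beta> \<alpha> (\<sigma> (0, 0, True) *\<^sub>v v)"
    and "\<sigma> (0, 0, True) *\<^sub>v (\<sigma> (0, 0, True) *\<^sub>v v) = v"
proof -
  from assms have v: "v \<in> carrier_vec n" "v \<noteq> 0\<^sub>v n"
    "\<And>a b. \<sigma> (a, b, False) *\<^sub>v v = (\<alpha> a * \<beta> b) \<cdot>\<^sub>v v"
    by (auto simp: base_eigenvector_def)
  show invol: "\<sigma> (0, 0, True) *\<^sub>v (\<sigma> (0, 0, True) *\<^sub>v v) = v"
    using v(1) representation_one[OF group_wreath_c2 rep] by (simp add: rep_mult_vec)
  have "\<sigma> (0, 0, True) *\<^sub>v v \<noteq> 0\<^sub>v n"
    using invol v(2) mult_mat_vec_zero[OF rep_carrier] by metis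
  moreover have "\<sigma> (a, b, False) *\<^sub>v (\<sigma> (0, 0, True) *\<^sub>v v) = (\<beta> a * \<alpha> b) \<cdot>\<^sub>v (\<sigma> (0, 0, True) *\<^sub>v v)" for a b
  proof -
    have "\<sigma> (a, b, False) *\<^sub>v (\<sigma> (0, 0, True) *\<^sub>v v) = \<sigma> (0, 0, True) *\<^sub>v (\<sigma> (b, a, False) *\<^sub>v v)"
      using v(1) by (simp add: rep_mult_vec)
    then show ?thesis
      using v(1) by (simp add: v(3) mult_mat_vec[OF rep_carrier] mult.commute)
  qed
  ultimately show "base_eigenvector n \<sigma> \<beta> \<alpha> (\<sigma> (0, 0, True) *\<^sub>v v)"
    using mult_mat_vec_carrier[OF rep_carrier v(1)] by (simp add: base_eigenvector_def)
qed

lemma base_eigenvector_swap_act: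
  assumes "base_eigenvector n \<sigma> \<alpha> \<beta> v"
  shows "\<sigma> (a, b, True) *\<^sub>v v = (\<beta> a * \<alpha> b) \<cdot>\<^sub>v (\<sigma> (0, 0, True) *\<^sub>v v)"
proof -
  have v: "v \<in> carrier_vec n" using assms by (simp add: base_eigenvector_def)
  have "\<sigma> (a, b, True) *\<^sub>v v = \<sigma> (a, b, False) *\<^sub>v (\<sigma> (0, 0, True) *\<^sub>v v)"
    using v by (simp add: rep_mult_vec)
  then show ?thesis
    using base_eigenvector_swap(1)[OF assms] by (simp add: base_eigenvector_def)
qed

end

section \<open>Classification of the irreducible representations\<close>

lemma mat_of_cols_mult_vec1:
  fixes v :: "'a::comm_ring_1 vec"
  shows "v \<in> carrier_vec n \<Longrightarrow> mat_of_cols n [v] *\<^sub>v vec 1 (\<lambda>_. x) = x \<cdot>\<^sub>v v"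
  by (intro eq_vecI) (auto simp: mat_of_cols_def scalar_prod_def mult.commute)

lemma mat_of_cols_mult_vec2:
  fixes v w :: "'a::comm_ring_1 vec"
  shows "v \<in> carrier_vec n \<Longrightarrow> w \<in> carrier_vec n \<Longrightarrow>
    mat_of_cols n [v, w] *\<^sub>v vec2 x y = x \<cdot>\<^sub>v v + y \<cdot>\<^sub>v w"
  by (intro eq_vecI) (auto simp: mat_of_cols_def vec2_def scalar_prod_def numeral_2_eq_2 mult.commute)

lemma mat_of_cols_nonzero:
  assumes "v \<in> carrier_vec n" "v \<noteq> 0\<^sub>v n"
  shows "mat_of_cols n (v # vs) \<noteq> 0\<^sub>m n (length (v # vs))"
proof
  assume "mat_of_cols n (v # vs) = 0\<^sub>m n (length (v # vs))"
  then have "col (mat_of_cols n (v # vs)) 0 = 0\<^sub>v n" by (simp add: col_zero)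
  then show False using assms by (simp add: col_mat_of_cols)
qed

text \<open>Let \<open>w\<close> be the swap applied to \<open>v\<close>. The sum
  \<open>v + w\<close> is fixed by the swap; if it vanishes, the swap negates \<open>v\<close>.
  Either way some vector is an eigenvector of the whole group, and as a single column it is a
  nonzero intertwiner for Schur's lemma.\<close>

lemma base_eigenvector_imp_isomorphic_linear:
  fixes \<sigma> :: "'h::{ab_group_add, finite} \<times> 'h \<times> bool \<Rightarrow> complex mat"
  assumes irr: "irreducible_representation wreath_c2 n \<sigma>" and \<alpha>: "character \<alpha>"
    and v: "base_eigenvector n \<sigma> \<alpha> \<alpha> v"
  shows "\<exists>u. isomorphic_representations wreath_c2 n \<sigma> 1 (linear_rep \<alpha> u)"
proof -
  have rep: "representation wreath_c2 n \<sigma>"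
    using irr by (simp add: irreducible_representation_def)
  define w where "w = \<sigma> (0, 0, True) *\<^sub>v v"
  note carr = rep_carrier[OF rep]
  from v have vc: "v \<in> carrier_vec n" "v \<noteq> 0\<^sub>v n" by (simp_all add: base_eigenvector_def)
  have wc: "w \<in> carrier_vec n" unfolding w_def using mult_mat_vec_carrier[OF carr vc(1)] .
  have invol: "\<sigma> (0, 0, True) *\<^sub>v w = v"
    unfolding w_def by (rule base_eigenvector_swap(2)[OF rep v])
  obtain u x where ux: "x \<in> carrier_vec n" "x \<noteq> 0\<^sub>v n" "base_eigenvector n \<sigma> \<alpha> \<alpha> x"
    "\<sigma> (0, 0, True) *\<^sub>v x = (if u then - 1 else 1) \<cdot>\<^sub>v x"
  proof (cases "v + w = 0\<^sub>v n")
    case True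
    have "w = - 1 \<cdot>\<^sub>v v"
    proof (rule eq_vecI)
      fix i assume "i < dim_vec (- 1 \<cdot>\<^sub>v v)"
      then have "(v + w) $ i = 0" "i < n" using True vc by simp_all
      then show "w $ i = (- 1 \<cdot>\<^sub>v v) $ i" using vc wc by (simp add: add_eq_0_iff)
    qed (use vc wc in simp)
    then show ?thesis using that[of v True] v vc by (simp add: w_def)
  next
    case False
    have "base_eigenvector n \<sigma> \<alpha> \<alpha> (v + w)"
      using False v base_eigenvector_swap(1)[OF rep v] vc wc
      by (auto simp: base_eigenvector_def w_def mult_add_distrib_mat_vec[OF carr] smult_add_distrib_vec[of _ n])
    moreover have "\<sigma> (0, 0, True) *\<^sub>v (v + w) = 1 \<cdot>\<^sub>v (v + w)"
      using vc wc invol comm_add_vec[OF vc(1) wc]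
      by (simp add: mult_add_distrib_mat_vec[OF carr] flip: w_def)
    ultimately show ?thesis using that[of "v + w" False] False vc wc by simp
  qed
  have act: "\<sigma> g *\<^sub>v x = (linear_rep \<alpha> u g $$ (0, 0)) \<cdot>\<^sub>v x" for g
  proof -
    obtain a b s where g: "g = (a, b, s)" by (cases g)
    show ?thesis
    proof (cases s)
      case False
      then show ?thesis using ux(3) by (simp add: g linear_rep_def base_eigenvector_def)
    next
      case True
      then show ?thesis
        using base_eigenvector_swap_act[OF rep ux(3), of a b] ux(4)
        by (simp add: g linear_rep_def smult_smult_assoc)
    qed
  qed
  have "isomorphic_representations wreath_c2 n \<sigma> 1 (linear_rep \<alpha> u)"
  proof (rule nonzero_intertwiner_imp_isomorphic[OF irr linear_rep_irreducible[OF \<alpha>]])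
    show P: "mat_of_cols n [x] \<in> carrier_mat n 1"
      using mat_of_cols_carrier(1)[of n "[x]"] by simp
    show "mat_of_cols n [x] \<noteq> 0\<^sub>m n 1" using mat_of_cols_nonzero[OF ux(1,2), of "[]"] by simp
    fix g :: "'h \<times> 'h \<times> bool"
    have col: "col (linear_rep \<alpha> u g) 0 = vec 1 (\<lambda>_. linear_rep \<alpha> u g $$ (0, 0))"
      using linear_rep_carrier[of \<alpha> u g] by (intro eq_vecI) auto
    show "\<sigma> g * mat_of_cols n [x] = mat_of_cols n [x] * linear_rep \<alpha> u g"
    proof (rule mat_col_eqI)
      fix j assume "j < dim_col (mat_of_cols n [x] * linear_rep \<alpha> u g)"
      then have j: "j = 0" using linear_rep_carrier[of \<alpha> u g] by simp
      have "col (\<sigma> g * mat_of_cols n [x]) 0 = \<sigma> g *\<^sub>v x"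
        using col_mult2[OF carr P] ux(1) by simp
      moreover have "col (mat_of_cols n [x] * linear_rep \<alpha> u g) 0 = (linear_rep \<alpha> u g $$ (0, 0)) \<cdot>\<^sub>v x"
      proof -
        have "col (mat_of_cols n [x] * linear_rep \<alpha> u g) 0 = mat_of_cols n [x] *\<^sub>v col (linear_rep \<alpha> u g) 0"
          by (rule col_mult2[OF P linear_rep_carrier]) simp
        then show ?thesis by (simp only: col mat_of_cols_mult_vec1[OF ux(1)])
      qed
      ultimately show "col (\<sigma> g * mat_of_cols n [x]) j = col (mat_of_cols n [x] * linear_rep \<alpha> u g) j"
        by (simp add: act j)
    qed (use carr[of g] linear_rep_carrier[of \<alpha> u g] in auto)
  qed
  then show ?thesis ..
qed

text \<open>The group permutes \<open>v\<close> and its swap \<open>w\<close> up to scalars exactly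
  as \<open>induced_rep\<close> does the two unit vectors. The matrix with columns \<open>v\<close>
  and \<open>w\<close> is thus an intertwiner, nonzero because \<open>v\<close> is, and Schur's
  lemma applies.\<close>

lemma base_eigenvector_imp_isomorphic_induced:
  fixes \<sigma> :: "'h::{ab_group_add, finite} \<times> 'h \<times> bool \<Rightarrow> complex mat"
  assumes irr: "irreducible_representation wreath_c2 n \<sigma>"
    and "character \<alpha>" "character \<beta>" "\<alpha> \<noteq> \<beta>"
    and v: "base_eigenvector n \<sigma> \<alpha> \<beta> v"
  shows "isomorphic_representations wreath_c2 n \<sigma> 2 (induced_rep \<alpha> \<beta>)"
proof -
  have rep: "representation wreath_c2 n \<sigma>"
    using irr by (simp add: irreducible_representation_def)
  define w where "w = \<sigma> (0, 0, True) *\<^sub>v v"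
  note carr = rep_carrier[OF rep]
  have w: "base_eigenvector n \<sigma> \<beta> \<alpha> w"
    unfolding w_def by (rule base_eigenvector_swap(1)[OF rep v])
  have invol: "\<sigma> (0, 0, True) *\<^sub>v w = v"
    unfolding w_def by (rule base_eigenvector_swap(2)[OF rep v])
  from v w have vw: "v \<in> carrier_vec n" "v \<noteq> 0\<^sub>v n" "w \<in> carrier_vec n"
    by (simp_all add: base_eigenvector_def)
  let ?P = "mat_of_cols n [v, w]"
  show ?thesis
  proof (rule nonzero_intertwiner_imp_isomorphic[OF irr induced_rep_irreducible[OF assms(2-4)]])
    show P: "?P \<in> carrier_mat n 2" using mat_of_cols_carrier(1)[of n "[v, w]"] by (simp add: numeral_2_eq_2)
    show "?P \<noteq> 0\<^sub>m n 2" using mat_of_cols_nonzero[OF vw(1,2), of "[w]"] by (simp add: numeral_2_eq_2)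
    fix g :: "'h \<times> 'h \<times> bool"
    obtain a b s where g: "g = (a, b, s)" by (cases g)
    have col0: "col (induced_rep \<alpha> \<beta> g) 0 = (if s then vec2 0 (\<beta> a * \<alpha> b) else vec2 (\<alpha> a * \<beta> b) 0)"
      by (rule eq_vecI) (auto simp: g induced_rep_def vec2_def)
    have col1: "col (induced_rep \<alpha> \<beta> g) 1 = (if s then vec2 (\<alpha> a * \<beta> b) 0 else vec2 0 (\<beta> a * \<alpha> b))"
      by (rule eq_vecI) (auto simp: g induced_rep_def vec2_def less_2_cases_iff)
    have Pv: "?P *\<^sub>v vec2 x 0 = x \<cdot>\<^sub>v v" and Pw: "?P *\<^sub>v vec2 0 x = x \<cdot>\<^sub>v w" for x
      unfolding mat_of_cols_mult_vec2[OF vw(1,3)] using vw by (auto intro!: eq_vecI)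
    have act_v: "\<sigma> g *\<^sub>v v = (if s then (\<beta> a * \<alpha> b) \<cdot>\<^sub>v w else (\<alpha> a * \<beta> b) \<cdot>\<^sub>v v)"
      using v base_eigenvector_swap_act[OF rep v, of a b] by (simp add: g base_eigenvector_def w_def)
    have act_w: "\<sigma> g *\<^sub>v w = (if s then (\<alpha> a * \<beta> b) \<cdot>\<^sub>v v else (\<beta> a * \<alpha> b) \<cdot>\<^sub>v w)"
      using w base_eigenvector_swap_act[OF rep w, of a b] by (simp add: g base_eigenvector_def invol)
    show "\<sigma> g * ?P = ?P * induced_rep \<alpha> \<beta> g"
    proof (rule mat_col_eqI)
      fix j assume "j < dim_col (?P * induced_rep \<alpha> \<beta> g)"
      then have j: "j < 2" using induced_rep_carrier[of \<alpha> \<beta> g] by simp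
      have l: "col (\<sigma> g * ?P) j = \<sigma> g *\<^sub>v ([v, w] ! j)"
        using col_mult2[OF carr P j] col_mat_of_cols[of j "[v, w]" n] vw(1,3) j
        by (auto simp: less_2_cases_iff)
      have r: "col (?P * induced_rep \<alpha> \<beta> g) j = ?P *\<^sub>v col (induced_rep \<alpha> \<beta> g) j"
        using col_mult2[OF P induced_rep_carrier j] .
      consider "j = 0" | "j = 1" using j by linarith
      then show "col (\<sigma> g * ?P) j = col (?P * induced_rep \<alpha> \<beta> g) j"
      proof cases
        case 1
        then show ?thesis unfolding l r unfolding 1 col0 by (simp add: Pv Pw act_v)
      next
        case 2
        then show ?thesis unfolding l r unfolding 2 col1 by (simp add: Pv Pw act_w)
      qed
    qed (use carr[of g] induced_rep_carrier[of \<alpha> \<beta> g] in auto)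
  qed
qed

text \<open>The induced case offers both orders of the characters, the second coming from the
  swapped eigenvector. Either order can then be matched with the one chosen to represent the
  unordered pair.\<close>

lemma irreducible_representation_wreath_c2_cases:
  fixes \<sigma> :: "'h::{ab_group_add, finite} \<times> 'h \<times> bool \<Rightarrow> complex mat"
  assumes irr: "irreducible_representation wreath_c2 n \<sigma>"
  obtains (linear) \<alpha> u where "character \<alpha>"
      "isomorphic_representations wreath_c2 n \<sigma> 1 (linear_rep \<alpha> u)"
    | (induced) \<alpha> \<beta> where "character \<alpha>" "character \<beta>" "\<alpha> \<noteq> \<beta>"
      "isomorphic_representations wreath_c2 n \<sigma> 2 (induced_rep \<alpha> \<beta>)"
      "isomorphic_representations wreath_c2 n \<sigma> 2 (induced_rep \<beta> \<alpha>)"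
proof -
  have rep: "representation wreath_c2 n \<sigma>" and "0 < n"
    using irr by (simp_all add: irreducible_representation_def)
  obtain v \<alpha> \<beta> where v: "character \<alpha>" "character \<beta>" "base_eigenvector n \<sigma> \<alpha> \<beta> v"
    using base_eigenvector_exists[OF rep \<open>0 < n\<close>] by blast
  show thesis
  proof (cases "\<alpha> = \<beta>")
    case True
    then have "base_eigenvector n \<sigma> \<alpha> \<alpha> v" using v(3) by simp
    from base_eigenvector_imp_isomorphic_linear[OF irr v(1) this] show thesis
      by (elim exE) (rule linear[OF v(1)])
  next
    case False
    show thesis
    proof (rule induced[OF v(1,2) False])
      show "isomorphic_representations wreath_c2 n \<sigma> 2 (induced_rep \<alpha> \<beta>)"
        by (rule base_eigenvector_imp_isomorphic_induced[OF irr v(1,2) False v(3)])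
      show "isomorphic_representations wreath_c2 n \<sigma> 2 (induced_rep \<beta> \<alpha>)"
        using False
        by (intro base_eigenvector_imp_isomorphic_induced[OF irr v(2,1) _ base_eigenvector_swap(1)[OF rep v(3)]]) simp
    qed
  qed
qed

section \<open>The list of character degrees\<close>

text \<open>Enumerating a finite index set without repetition gives the list of degrees; the second
  conclusion moves sums over this list back to the index set.\<close>

lemma character_degrees_of_index_set:
  assumes "finite I"
    and irr: "\<And>i. i \<in> I \<Longrightarrow> irreducible_representation G (d i) (\<rho> i)"
    and inj: "\<And>i j. i \<in> I \<Longrightarrow> j \<in> I \<Longrightarrow>
      isomorphic_representations G (d i) (\<rho> i) (d j) (\<rho> j) \<Longrightarrow> i = j"
    and complete: "\<And>n \<sigma>. irreducible_representation G n \<sigma> \<Longrightarrow>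
      \<exists>i\<in>I. isomorphic_representations G n \<sigma> (d i) (\<rho> i)"
  obtains ds where "character_degrees G ds" "\<And>f :: nat \<Rightarrow> nat. (\<Sum>x\<leftarrow>ds. f x) = (\<Sum>i\<in>I. f (d i))"
proof -
  obtain xs where xs: "set xs = I" "distinct xs"
    using finite_distinct_list[OF assms(1)] by blast
  show thesis
  proof (rule that[of "map d xs"])
    show "character_degrees G (map d xs)"
      unfolding character_degrees_def
    proof (intro exI[of _ "map \<rho> xs"] conjI allI impI)
      fix i assume "i < length (map d xs)"
      then show "irreducible_representation G (map d xs ! i) (map \<rho> xs ! i)"
        using irr xs(1) by auto
    next
      fix i j
      assume "i < length (map d xs)" "j < length (map d xs)"
        "isomorphic_representations G (map d xs ! i) (map \<rho> xs ! i) (map d xs ! j) (map \<rho> xs ! j)"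
      then show "i = j"
        using inj[of "xs ! i" "xs ! j"] nth_mem[of i xs] nth_mem[of j xs] xs
        by (simp add: nth_eq_iff_index_eq)
    next
      fix n \<sigma>
      assume "irreducible_representation G n \<sigma>"
      from complete[OF this] obtain i where "i < length xs"
        "isomorphic_representations G n \<sigma> (d (xs ! i)) (\<rho> (xs ! i))"
        using xs(1) by (auto simp: in_set_conv_nth)
      then show "\<exists>i<length (map d xs). isomorphic_representations G n \<sigma> (map d xs ! i) (map \<rho> xs ! i)"
        by auto
    qed simp
    show "(\<Sum>x\<leftarrow>map d xs. f x) = (\<Sum>i\<in>I. f (d i))" for f :: "nat \<Rightarrow> nat"
      using xs by (simp add: sum_list_distinct_conv_sum_set comp_def)
  qed
qed

text \<open>There are \<open>2 * N\<close> degrees equal to 1 and \<open>N * (N - 1) / 2\<close>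
  equal to 2, each of the latter contributing 8. The term \<open>2 * N\<close> stands on the left to
  avoid truncated subtraction.\<close>

lemma character_degrees_wreath_c2:
  assumes fin: "finite {\<alpha> :: 'h::{ab_group_add, finite} \<Rightarrow> complex. character \<alpha>}"
  defines "N \<equiv> card {\<alpha> :: 'h \<Rightarrow> complex. character \<alpha>}"
  obtains ds where "character_degrees (wreath_c2 :: ('h \<times> 'h \<times> bool) monoid) ds"
    "(\<Sum>d\<leftarrow>ds. d ^ 3) + 2 * N = 4 * N ^ 2"
proof -
  let ?X = "{\<alpha> :: 'h \<Rightarrow> complex. character \<alpha>}"
  obtain e where e: "bij_betw e {..<N} ?X"
    using ex_bij_betw_nat_finite[OF fin] by (auto simp: N_def lessThan_atLeast0)
  have char: "character (e i)" if "i < N" for i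
    using bij_betwE[OF e] that by auto
  have e_eq: "e i = e j \<longleftrightarrow> i = j" if "i < N" "j < N" for i j
    using e that by (auto simp: bij_betw_def inj_on_def)
  have e_surj: "\<exists>i<N. e i = \<alpha>" if "character \<alpha>" for \<alpha>
  proof -
    have "\<alpha> \<in> e ` {..<N}" using bij_betw_imp_surj_on[OF e] that by simp
    then show ?thesis by auto
  qed
  \<comment> \<open>\<open>Inl (i, u)\<close> indexes a linear representation;
    \<open>Inr (j, i)\<close> with \<open>i < j\<close> indexes the unordered pair of distinct
    characters \<open>e i\<close> and \<open>e j\<close>.\<close>
  define I where "I = ({..<N} \<times> (UNIV :: bool set)) <+> Sigma {..<N} (\<lambda>j. {..<j})"
  define d :: "(nat \<times> bool) + (nat \<times> nat) \<Rightarrow> nat" where "d = case_sum (\<lambda>_. 1) (\<lambda>_. 2)"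
  define \<rho> where "\<rho> = case_sum (\<lambda>(i, u). linear_rep (e i) u) (\<lambda>(j, i). induced_rep (e i) (e j))"
  have d_simps [simp]: "d (Inl x) = 1" "d (Inr y) = 2" for x y by (simp_all add: d_def)
  obtain ds where ds: "character_degrees (wreath_c2 :: ('h \<times> 'h \<times> bool) monoid) ds"
    "\<And>f :: nat \<Rightarrow> nat. (\<Sum>x\<leftarrow>ds. f x) = (\<Sum>i\<in>I. f (d i))"
  proof (rule character_degrees_of_index_set[of I wreath_c2 d \<rho>])
    show "finite I" by (auto simp: I_def)
  next
    fix x assume "x \<in> I"
    then consider i u where "x = Inl (i, u)" "i < N" | j i where "x = Inr (j, i)" "j < N" "i < j"
      by (auto simp: I_def)
    then show "irreducible_representation wreath_c2 (d x) (\<rho> x)"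
    proof cases
      case 1
      then show ?thesis using linear_rep_irreducible[OF char[of i], of u] by (simp add: \<rho>_def)
    next
      case 2
      then show ?thesis
        using induced_rep_irreducible[OF char[of i] char[of j]] e_eq[of i j] by (simp add: \<rho>_def)
    qed
  next
    fix x y assume xy: "x \<in> I" "y \<in> I" "isomorphic_representations wreath_c2 (d x) (\<rho> x) (d y) (\<rho> y)"
    then have "d x = d y" by (simp add: isomorphic_representations_def)
    then consider i u i' u' where "x = Inl (i, u)" "y = Inl (i', u')" "i < N" "i' < N"
      | j i j' i' where "x = Inr (j, i)" "y = Inr (j', i')" "j < N" "i < j" "j' < N" "i' < j'"
      using xy(1,2) by (auto simp: I_def)
    then show "x = y"
    proof cases
      case 1
      then show ?thesis
        using linear_rep_isomorphic_imp_eq[OF char[of i] char[of i'], of u u'] xy(3) e_eq[of i i']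
        by (simp add: \<rho>_def)
    next
      case 2
      then have "e i = e i' \<and> e j = e j' \<or> e i = e j' \<and> e j = e i'"
        using xy(3) by (intro induced_rep_isomorphic_imp_eq) (auto simp: \<rho>_def intro!: char)
      \<comment> \<open>The order conditions \<open>i < j\<close> and \<open>i' < j'\<close> exclude
        the crossed match.\<close>
      then show ?thesis
        using 2 e_eq[of i i'] e_eq[of j j'] e_eq[of i j'] e_eq[of j i'] by auto
    qed
  next
    fix n and \<sigma> :: "'h \<times> 'h \<times> bool \<Rightarrow> complex mat"
    assume "irreducible_representation wreath_c2 n \<sigma>"
    then show "\<exists>x\<in>I. isomorphic_representations wreath_c2 n \<sigma> (d x) (\<rho> x)"
    proof (cases rule: irreducible_representation_wreath_c2_cases)
      case (linear \<alpha> u)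
      obtain i where i: "i < N" "e i = \<alpha>" using e_surj[OF linear(1)] by blast
      have "Inl (i, u) \<in> I" using i by (auto simp: I_def)
      moreover have "isomorphic_representations wreath_c2 n \<sigma> (d (Inl (i, u))) (\<rho> (Inl (i, u)))"
        using linear(2) i by (simp add: \<rho>_def)
      ultimately show ?thesis by blast
    next
      case (induced \<alpha> \<beta>)
      obtain i where i: "i < N" "e i = \<alpha>" using e_surj[OF induced(1)] by blast
      obtain j where j: "j < N" "e j = \<beta>" using e_surj[OF induced(2)] by blast
      have "i \<noteq> j" using i j induced(3) by blast
      then consider "i < j" | "j < i" by linarith
      then show ?thesis
      proof cases
        case 1
        then show ?thesis
          using i j induced(4) by (intro bexI[of _ "Inr (j, i)"]) (auto simp: I_def \<rho>_def)
      next
        case 2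
        then show ?thesis
          using i j induced(5) by (intro bexI[of _ "Inr (i, j)"]) (auto simp: I_def \<rho>_def)
      qed
    qed
  qed (rule that)
  have card: "card (Sigma {..<N} (\<lambda>j. {..<j})) = (\<Sum>j<N. j)" by simp
  have "2 * (\<Sum>j<N. j) + N = N ^ 2"
    by (induction N) (auto simp: power2_eq_square)
  moreover have "(\<Sum>i\<in>I. d i ^ 3) = 2 * N + 8 * (\<Sum>j<N. j)"
    unfolding I_def by (subst sum.Plus) (simp_all add: card)
  ultimately have "(\<Sum>d\<leftarrow>ds. d ^ 3) + 2 * N = 4 * N ^ 2"
    using ds(2)[of "\<lambda>d. d ^ 3"] by linarith
  then show thesis using that ds(1) by blast
qed

section \<open>Transport along isomorphisms\<close>

lemma irreducible_representation_iso_comp: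
  assumes f: "f \<in> iso G G'" and \<sigma>: "irreducible_representation G' n \<sigma>"
  shows "irreducible_representation G n (\<sigma> \<circ> f)"
proof -
  have "carrier G' = f ` carrier G" using f by (auto simp: iso_def bij_betw_def)
  moreover have "representation G n (\<sigma> \<circ> f)"
    using f \<sigma> unfolding irreducible_representation_def representation_def
    by (auto intro: hom_compose simp: iso_def)
  ultimately show ?thesis
    using \<sigma> unfolding irreducible_representation_def by simp
qed

lemma isomorphic_representations_iso_comp:
  assumes "f \<in> iso G G'"
  shows "isomorphic_representations G m (\<rho> \<circ> f) n (\<sigma> \<circ> f) \<longleftrightarrow> isomorphic_representations G' m \<rho> n \<sigma>"
proof -
  have "carrier G' = f ` carrier G" using assms by (auto simp: iso_def bij_betw_def)
  then show ?thesis unfolding isomorphic_representations_def by simp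
qed

text \<open>Pulling back along the inverse of \<open>f\<close> transports the complete list, while
  completeness is checked by pulling an arbitrary representation back along
  \<open>f\<close>.\<close>

lemma character_degrees_iso:
  assumes G: "group G" and f: "f \<in> iso G G'" and "character_degrees G ds"
  shows "character_degrees G' ds"
proof -
  let ?g = "inv_into (carrier G) f"
  have g: "?g \<in> iso G' G" using group.iso_set_sym[OF G f] .
  have gf: "?g (f x) = x" if "x \<in> carrier G" for x
    using f that by (simp add: iso_def bij_betw_def)
  obtain \<rho>s where len: "length \<rho>s = length ds"
    and irr: "\<forall>i<length ds. irreducible_representation G (ds ! i) (\<rho>s ! i)"
    and inj: "\<forall>i<length ds. \<forall>j<length ds.
      isomorphic_representations G (ds ! i) (\<rho>s ! i) (ds ! j) (\<rho>s ! j) \<longrightarrow> i = j"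
    and complete: "\<And>n \<sigma>. irreducible_representation G n \<sigma> \<Longrightarrow>
      \<exists>i<length ds. isomorphic_representations G n \<sigma> (ds ! i) (\<rho>s ! i)"
    using assms(3) unfolding character_degrees_def by blast
  show ?thesis
    unfolding character_degrees_def
  proof (intro exI[of _ "map (\<lambda>\<rho>. \<rho> \<circ> ?g) \<rho>s"] conjI allI impI)
    fix i assume "i < length ds"
    then show "irreducible_representation G' (ds ! i) (map (\<lambda>\<rho>. \<rho> \<circ> ?g) \<rho>s ! i)"
      using irr len by (simp add: irreducible_representation_iso_comp[OF g])
  next
    fix i j assume "i < length ds" "j < length ds"
      "isomorphic_representations G' (ds ! i) (map (\<lambda>\<rho>. \<rho> \<circ> ?g) \<rho>s ! i) (ds ! j) (map (\<lambda>\<rho>. \<rho> \<circ> ?g) \<rho>s ! j)"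
    then show "i = j"
      using inj len by (simp add: isomorphic_representations_iso_comp[OF g])
  next
    fix n \<sigma> assume "irreducible_representation G' n \<sigma>"
    then obtain i where i: "i < length ds" "isomorphic_representations G n (\<sigma> \<circ> f) (ds ! i) (\<rho>s ! i)"
      using complete irreducible_representation_iso_comp[OF f] by blast
    \<comment> \<open>Composing with \<open>f\<close> and then its inverse changes nothing on
      \<open>carrier G\<close>, the only place where isomorphism compares representations.\<close>
    have "isomorphic_representations G n (\<sigma> \<circ> f) (ds ! i) (\<rho>s ! i \<circ> ?g \<circ> f)"
      using i(2) gf unfolding isomorphic_representations_def by simp
    then have "isomorphic_representations G' n \<sigma> (ds ! i) (\<rho>s ! i \<circ> ?g)"
      by (simp only: isomorphic_representations_iso_comp[OF f])
    then show "\<exists>i<length ds. isomorphic_representations G' n \<sigma> (ds ! i) (map (\<lambda>\<rho>. \<rho> \<circ> ?g) \<rho>s ! i)"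
      using i(1) len by auto
  qed (simp add: len)
qed

text \<open>Quotient sets are mapped to quotient sets, and injectivity of \<open>f\<close> reflects
  the identity.\<close>

lemma triple_product_property_iso:
  assumes G: "group G" and G': "group G'" and f: "f \<in> iso G G'"
    and S: "S1 \<subseteq> carrier G" "S2 \<subseteq> carrier G" "S3 \<subseteq> carrier G"
    and tpp: "triple_product_property G S1 S2 S3"
  shows "triple_product_property G' (f ` S1) (f ` S2) (f ` S3)"
proof -
  interpret group_hom G G' f
    using G G' f by (simp add: group_hom_def group_hom_axioms_def iso_def)
  have inj: "inj_on f (carrier G)" using f by (simp add: iso_def bij_betw_def)
  have Q: "quotient_set G' (f ` S) = f ` quotient_set G S" "quotient_set G S \<subseteq> carrier G"
    if "S \<subseteq> carrier G" for S
  proof -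
    have mult: "f s \<otimes>\<^bsub>G'\<^esub> inv\<^bsub>G'\<^esub> f t = f (s \<otimes>\<^bsub>G\<^esub> inv\<^bsub>G\<^esub> t)" if "s \<in> S" "t \<in> S" for s t
      using that \<open>S \<subseteq> carrier G\<close> by (simp add: subset_iff)
    have "quotient_set G' (f ` S) = (\<lambda>(s, t). f s \<otimes>\<^bsub>G'\<^esub> inv\<^bsub>G'\<^esub> f t) ` (S \<times> S)"
      by (auto simp: quotient_set_def)
    also have "\<dots> = (\<lambda>(s, t). f (s \<otimes>\<^bsub>G\<^esub> inv\<^bsub>G\<^esub> t)) ` (S \<times> S)"
      using mult by (intro image_cong) auto
    also have "\<dots> = f ` quotient_set G S"
      by (auto simp: quotient_set_def)
    finally show "quotient_set G' (f ` S) = f ` quotient_set G S" .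
    show "quotient_set G S \<subseteq> carrier G"
      using that by (auto simp: quotient_set_def)
  qed
  have one: "f x = \<one>\<^bsub>G'\<^esub> \<longleftrightarrow> x = \<one>\<^bsub>G\<^esub>" if "x \<in> carrier G" for x
    using inj_on_eq_iff[OF inj that, of "\<one>\<^bsub>G\<^esub>"] by simp
  show ?thesis
    unfolding triple_product_property_def Q(1)[OF S(1)] Q(1)[OF S(2)] Q(1)[OF S(3)] ball_simps(9)
  proof (intro ballI impI)
    fix p q r assume pqr: "p \<in> quotient_set G S1" "q \<in> quotient_set G S2" "r \<in> quotient_set G S3"
      and eq: "f p \<otimes>\<^bsub>G'\<^esub> f q \<otimes>\<^bsub>G'\<^esub> f r = \<one>\<^bsub>G'\<^esub>"
    have c: "p \<in> carrier G" "q \<in> carrier G" "r \<in> carrier G"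
      using pqr Q(2)[OF S(1)] Q(2)[OF S(2)] Q(2)[OF S(3)] by blast+
    then have "p \<otimes>\<^bsub>G\<^esub> q \<otimes>\<^bsub>G\<^esub> r = \<one>\<^bsub>G\<^esub>"
      using eq one[of "p \<otimes>\<^bsub>G\<^esub> q \<otimes>\<^bsub>G\<^esub> r"] by simp
    then show "f p = \<one>\<^bsub>G'\<^esub> \<and> f q = \<one>\<^bsub>G'\<^esub> \<and> f r = \<one>\<^bsub>G'\<^esub>"
      using tpp pqr c by (auto simp: triple_product_property_def one)
  qed
qed

section \<open>The example\<close>

text \<open>Equal flags cancel and leave coordinatewise differences. Unequal flags pair each
  coordinate with the opposite one, in the same way whichever of the two elements carries the
  swap.\<close>

lemma quotient_set_wreath_c2:
  fixes A B :: "'h::ab_group_add set"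
  assumes "q \<in> quotient_set wreath_c2 (A \<times> B \<times> UNIV)"
  obtains (base) a a' b b' where "a \<in> A" "a' \<in> A" "b \<in> B" "b' \<in> B" "q = (a - a', b - b', False)"
    | (swap) a a' b b' where "a \<in> A" "a' \<in> A" "b \<in> B" "b' \<in> B" "q = (a - b', b - a', True)"
proof -
  obtain a b s a' b' s' where ab: "a \<in> A" "a' \<in> A" "b \<in> B" "b' \<in> B"
    and q: "q = (a, b, s) \<otimes>\<^bsub>wreath_c2\<^esub> inv\<^bsub>wreath_c2\<^esub> (a', b', s')"
    using assms by (auto simp: quotient_set_def)
  show thesis
    using q by (cases s; cases s') (auto intro: base[OF ab] swap[OF ab])
qed

text \<open>An odd number of swaps leaves the flag \<open>True\<close>. Without swaps, the three
  differences in each component lie on different axes and must all vanish. If \<open>p\<close> and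
  \<open>q\<close> swap, axis 1 of the first component is an entry of \<open>p\<close> from
  \<open>A\<close>; if \<open>q\<close> and \<open>r\<close> do, axis 2 of the first component is
  one of \<open>q\<close>; if \<open>p\<close> and \<open>r\<close> do, axis 3 of the second
  component is one of \<open>r\<close>. These are nonzero.\<close>

lemma triple_product_property_wreath_c2_axes:
  fixes A :: "'k::ab_group_add set"
  assumes "0 \<notin> A"
  shows "triple_product_property wreath_c2
    (((\<lambda>x. (x, 0, 0)) ` A) \<times> range (\<lambda>x. (0, x, 0)) \<times> UNIV)
    (((\<lambda>x. (0, x, 0)) ` A) \<times> range (\<lambda>x. (0, 0, x)) \<times> UNIV)
    (((\<lambda>x. (0, 0, x)) ` A) \<times> range (\<lambda>x. (x, 0, 0)) \<times> UNIV)"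
  unfolding triple_product_property_def
proof (intro ballI impI)
  fix p q r :: "('k \<times> 'k \<times> 'k) \<times> ('k \<times> 'k \<times> 'k) \<times> bool"
  assume "p \<in> quotient_set wreath_c2 (((\<lambda>x. (x, 0, 0)) ` A) \<times> range (\<lambda>x. (0, x, 0)) \<times> UNIV)"
    "q \<in> quotient_set wreath_c2 (((\<lambda>x. (0, x, 0)) ` A) \<times> range (\<lambda>x. (0, 0, x)) \<times> UNIV)"
    "r \<in> quotient_set wreath_c2 (((\<lambda>x. (0, 0, x)) ` A) \<times> range (\<lambda>x. (x, 0, 0)) \<times> UNIV)"
    "p \<otimes>\<^bsub>wreath_c2\<^esub> q \<otimes>\<^bsub>wreath_c2\<^esub> r = \<one>\<^bsub>wreath_c2\<^esub>"
  then show "p = \<one>\<^bsub>wreath_c2\<^esub> \<and> q = \<one>\<^bsub>wreath_c2\<^esub> \<and> r = \<one>\<^bsub>wreath_c2\<^esub>"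
    using assms
    by (elim quotient_set_wreath_c2) (auto simp: zero_prod_def)
qed

section \<open>Bounding the number of characters\<close>

text \<open>A character is determined by its values on the three generators, and each value is a
  fifth root of unity.\<close>

lemma card_characters_Z5_cubed:
  "finite {\<alpha> :: 5 \<times> 5 \<times> 5 \<Rightarrow> complex. character \<alpha>}"
  "card {\<alpha> :: 5 \<times> 5 \<times> 5 \<Rightarrow> complex. character \<alpha>} \<le> 125"
proof -
  let ?X = "{\<alpha> :: 5 \<times> 5 \<times> 5 \<Rightarrow> complex. character \<alpha>}"
  let ?R = "{z :: complex. z ^ 5 = 1}"
  let ?\<Phi> = "\<lambda>\<alpha> :: 5 \<times> 5 \<times> 5 \<Rightarrow> complex. (\<alpha> (1, 0, 0), \<alpha> (0, 1, 0), \<alpha> (0, 0, 1))"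
  have pow: "\<alpha> (of_nat k, 0, 0) = \<alpha> (1, 0, 0) ^ k" "\<alpha> (0, of_nat k, 0) = \<alpha> (0, 1, 0) ^ k"
    "\<alpha> (0, 0, of_nat k) = \<alpha> (0, 0, 1) ^ k" if "character \<alpha>" for \<alpha> :: "5 \<times> 5 \<times> 5 \<Rightarrow> complex" and k
  proof (induction k)
    case (Suc k)
    { case 1
      show ?case using Suc character_add[OF that, of "(1, 0, 0)" "(of_nat k, 0, 0)"] by simp
    next
      case 2
      show ?case using Suc character_add[OF that, of "(0, 1, 0)" "(0, of_nat k, 0)"] by simp
    next
      case 3
      show ?case using Suc character_add[OF that, of "(0, 0, 1)" "(0, 0, of_nat k)"] by simp }
  qed (use character_0[OF that] in \<open>simp_all add: zero_prod_def\<close>)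
  \<comment> \<open>In the type \<open>5\<close> five equals zero, so the fifth power of each
    generator value is the character's value at 0, namely 1.\<close>
  have five: "(of_nat 5 :: 5) = 0" by simp
  have maps: "?\<Phi> ` ?X \<subseteq> ?R \<times> ?R \<times> ?R"
  proof
    fix z assume "z \<in> ?\<Phi> ` ?X"
    then obtain \<alpha> where \<alpha>: "character \<alpha>" "z = ?\<Phi> \<alpha>" by blast
    then show "z \<in> ?R \<times> ?R \<times> ?R"
      using pow[OF \<alpha>(1), of 5, symmetric] character_0[OF \<alpha>(1)] unfolding five by (simp add: zero_prod_def)
  qed
  have inj: "inj_on ?\<Phi> ?X"
  proof (rule inj_onI)
    fix \<alpha> \<beta> assume ab: "\<alpha> \<in> ?X" "\<beta> \<in> ?X" "?\<Phi> \<alpha> = ?\<Phi> \<beta>"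
    have nat: "\<exists>k. x = of_nat k" for x :: 5
      by (cases x) (metis of_int_of_nat_eq zero_le_imp_eq_int)
    have split: "\<gamma> (x, y, z) = \<gamma> (x, 0, 0) * (\<gamma> (0, y, 0) * \<gamma> (0, 0, z))" if "character \<gamma>"
      for \<gamma> :: "5 \<times> 5 \<times> 5 \<Rightarrow> complex" and x y z
      using character_add[OF that, of "(x, 0, 0)" "(0, y, z)"]
        character_add[OF that, of "(0, y, 0)" "(0, 0, z)"] by simp
    have "\<alpha> (x, y, z) = \<beta> (x, y, z)" for x y z
    proof -
      obtain i j k where "x = of_nat i" "y = of_nat j" "z = of_nat k" using nat by metis
      then show ?thesis
        using ab split[of \<alpha> x y z] split[of \<beta> x y z] by (simp add: pow)
    qed
    then show "\<alpha> = \<beta>" by auto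
  qed
  have "finite ?R" by (rule finite_roots_unity) simp
  then have fin: "finite (?R \<times> ?R \<times> ?R)" by (intro finite_cartesian_product)
  then show "finite ?X" using inj maps by (meson finite_imageD finite_subset)
  have "card ?X \<le> card (?R \<times> ?R \<times> ?R)" using card_inj_on_le[OF inj maps fin] .
  then show "card ?X \<le> 125" by (simp add: card_roots_unity_eq card_cartesian_product)
qed

theorem mainTheorem1:
  shows "\<exists>(G :: nat monoid) S1 S2 S3 ds.
    group G \<and> finite (carrier G) \<and>
    S1 \<subseteq> carrier G \<and> S2 \<subseteq> carrier G \<and> S3 \<subseteq> carrier G \<and>
    triple_product_property G S1 S2 S3 \<and>
    character_degrees G ds \<and>
    card S1 * card S2 * card S3 > (\<Sum>d\<leftarrow>ds. d ^ 3)"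
proof -
  define W :: "((5 \<times> 5 \<times> 5) \<times> (5 \<times> 5 \<times> 5) \<times> bool) monoid" where "W = wreath_c2"
  have W: "group W" "carrier W = UNIV" by (simp_all add: W_def group_wreath_c2)
  define T1 :: "((5 \<times> 5 \<times> 5) \<times> (5 \<times> 5 \<times> 5) \<times> bool) set"
    where "T1 = ((\<lambda>x. (x, 0, 0)) ` (- {0})) \<times> range (\<lambda>x. (0, x, 0)) \<times> UNIV"
  define T2 :: "((5 \<times> 5 \<times> 5) \<times> (5 \<times> 5 \<times> 5) \<times> bool) set"
    where "T2 = ((\<lambda>x. (0, x, 0)) ` (- {0})) \<times> range (\<lambda>x. (0, 0, x)) \<times> UNIV"
  define T3 :: "((5 \<times> 5 \<times> 5) \<times> (5 \<times> 5 \<times> 5) \<times> bool) set"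
    where "T3 = ((\<lambda>x. (0, 0, x)) ` (- {0})) \<times> range (\<lambda>x. (x, 0, 0)) \<times> UNIV"
  \<comment> \<open>Each set has 4 nonzero entries, 5 arbitrary ones and 2 flags to choose
    from.\<close>
  have card: "card T1 = 40" "card T2 = 40" "card T3 = 40"
    by (simp_all add: T1_def T2_def T3_def card_cartesian_product card_image inj_on_def Compl_eq_Diff_UNIV card_Diff_singleton)
  have tpp: "triple_product_property W T1 T2 T3"
    unfolding W_def T1_def T2_def T3_def by (rule triple_product_property_wreath_c2_axes) simp
  define N where "N = card {\<alpha> :: 5 \<times> 5 \<times> 5 \<Rightarrow> complex. character \<alpha>}"
  obtain ds where ds: "character_degrees W ds" "(\<Sum>d\<leftarrow>ds. d ^ 3) + 2 * N = 4 * N ^ 2"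
    unfolding W_def N_def using character_degrees_wreath_c2[OF card_characters_Z5_cubed(1)] .
  have "(\<Sum>d\<leftarrow>ds. d ^ 3) < 40 * 40 * 40"
  proof -
    have "N \<le> 125" using card_characters_Z5_cubed(2) by (simp add: N_def)
    \<comment> \<open>This linearises the square: the sum is at most \<open>498 * N\<close>, hence
      at most 62250.\<close>
    moreover from this have "N * N \<le> 125 * N" by (rule mult_le_mono1)
    ultimately show ?thesis using ds(2) unfolding power2_eq_square by linarith
  qed
  \<comment> \<open>The group has to live on natural numbers, so it is copied along an injective
    encoding of its finite carrier.\<close>
  let ?f = "to_nat :: (5 \<times> 5 \<times> 5) \<times> (5 \<times> 5 \<times> 5) \<times> bool \<Rightarrow> nat"
  let ?G = "image_group ?f W"
  have inj: "inj_on ?f S" for S by (rule inj_on_subset[OF inj_to_nat]) simp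
  have G: "group ?G" and f: "?f \<in> iso W ?G"
    using group.inj_imp_image_group_is_group[OF W(1) inj] inj_imp_image_group_iso[OF inj] by blast+
  have carrier: "carrier ?G = range ?f" by (simp add: image_group_carrier W)
  show ?thesis
  proof (intro exI conjI)
    show "triple_product_property ?G (?f ` T1) (?f ` T2) (?f ` T3)"
      by (rule triple_product_property_iso[OF W(1) G f _ _ _ tpp]) (simp_all add: W)
    show "character_degrees ?G ds" by (rule character_degrees_iso[OF W(1) f ds(1)])
    show "(\<Sum>d\<leftarrow>ds. d ^ 3) < card (?f ` T1) * card (?f ` T2) * card (?f ` T3)"
      using \<open>(\<Sum>d\<leftarrow>ds. d ^ 3) < 40 * 40 * 40\<close> by (simp add: card_image[OF inj] card)
  qed (use G carrier in auto)
qed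

end
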